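(* Let $G$ be a finite primitive permutation group (on a finite set of size at least $2$) and suppose that there is a fixed prime $r$ such that every derangement in $G$ is an $r$-element. Then $G$ is either almost simple or affine.
   Context: A derangement in a permutation group $G\leqslant \mathrm{Sym}(\Omega)$ is an element of $G$ with no fixed points on $\Omega$. An $r$-element is an element whose order is a power of $r$. $G$ is almost simple if there is a nonabelian finite simple group $S$ with $S \leqslant G\leqslant \mathrm{Aut}(S)$ (up to isomorphism, identifying $S$ with $\mathrm{Inn}(S)$). A primitive group $G$ is affine if its socle is an elementary abelian $p$-group $V=(\mathbb{Z}_p)^k$ ($p$ prime, $k\geqslant 1$) acting regularly, so that $G=HV\leqslant \mathrm{AGL}(V)$ with $H\leqslant \mathrm{GL}(V)$ a point stabilizer. *)

theory Defs
  imports "HOL-Algebra.Algebra" "HOL-Library.Disjoint_Sets"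
begin

abbreviation perm_group :: "'a set \<Rightarrow> ('a \<Rightarrow> 'a) set \<Rightarrow> ('a \<Rightarrow> 'a) monoid"
  where "perm_group \<Omega> G \<equiv> BijGroup \<Omega> \<lparr>carrier := G\<rparr>"

definition transitive_on :: "'a set \<Rightarrow> ('a \<Rightarrow> 'a) set \<Rightarrow> bool"
  where "transitive_on \<Omega> G \<longleftrightarrow> transitive_action (perm_group \<Omega> G) \<Omega> (\<lambda>g. g)"

(* Transitivity does not follow from the partition condition when \<Omega> has exactly
   two points, so it is required separately. *)
definition primitive_perm_group :: "'a set \<Rightarrow> ('a \<Rightarrow> 'a) set \<Rightarrow> bool"
  where "primitive_perm_group \<Omega> G \<longleftrightarrow>
    subgroup G (BijGroup \<Omega>) \<and> transitive_on \<Omega> G \<and>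
    (\<forall>P. partition_on \<Omega> P \<and> (\<forall>g\<in>G. \<forall>B\<in>P. g ` B \<in> P)
       \<longrightarrow> P = {\<Omega>} \<or> P = (\<lambda>x. {x}) ` \<Omega>)"

definition derangement :: "'a set \<Rightarrow> ('a \<Rightarrow> 'a) \<Rightarrow> bool"
  where "derangement \<Omega> g \<longleftrightarrow> invariants \<Omega> (\<lambda>g. g) g = {}"

definition r_element :: "('a, 'b) monoid_scheme \<Rightarrow> nat \<Rightarrow> 'a \<Rightarrow> bool"
  where "r_element G r g \<longleftrightarrow> (\<exists>m::nat. group.ord G g = r ^ m)"

definition inner_auts :: "('a, 'b) monoid_scheme \<Rightarrow> ('a \<Rightarrow> 'a) set"
  where "inner_auts S =
    (\<lambda>s. \<lambda>x\<in>carrier S. s \<otimes>\<^bsub>S\<^esub> x \<otimes>\<^bsub>S\<^esub> inv\<^bsub>S\<^esub> s) ` carrier S"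

(* S ranges over groups on the element type of G. This loses no generality: since S has
   trivial centre it is isomorphic to Inn(S), hence to a subgroup of G. *)
definition almost_simple :: "('a, 'b) monoid_scheme \<Rightarrow> bool"
  where "almost_simple G \<longleftrightarrow>
    (\<exists>S :: 'a monoid. simple_group S \<and> finite (carrier S) \<and> \<not> comm_group S \<and>
      (\<exists>K. subgroup K (AutoGroup S) \<and> inner_auts S \<subseteq> K \<and>
           G \<cong> AutoGroup S \<lparr>carrier := K\<rparr>))"

definition minimal_normal :: "'a set \<Rightarrow> ('a, 'b) monoid_scheme \<Rightarrow> bool"
  where "minimal_normal N G \<longleftrightarrow>
    N \<lhd> G \<and> N \<noteq> {\<one>\<^bsub>G\<^esub>} \<and>
    (\<forall>M. M \<lhd> G \<and> M \<subseteq> N \<longrightarrow> M = {\<one>\<^bsub>G\<^esub>} \<or> M = N)"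

definition socle :: "('a, 'b) monoid_scheme \<Rightarrow> 'a set"
  where "socle G = generate G (\<Union>{N. minimal_normal N G})"

definition regular_on :: "'a set \<Rightarrow> ('a \<Rightarrow> 'a) set \<Rightarrow> bool"
  where "regular_on \<Omega> V \<longleftrightarrow>
    transitive_on \<Omega> V \<and>
    (\<forall>x\<in>\<Omega>. stabilizer (perm_group \<Omega> V) (\<lambda>g. g) x = {\<one>\<^bsub>BijGroup \<Omega>\<^esub>})"

definition affine_perm_group :: "'a set \<Rightarrow> ('a \<Rightarrow> 'a) set \<Rightarrow> bool"
  where "affine_perm_group \<Omega> G \<longleftrightarrow>
    (let V = socle (perm_group \<Omega> G) in
      (\<exists>(p::nat) (k::nat). Factorial_Ring.prime p \<and> k \<ge> 1 \<and>
         perm_group \<Omega> V \<cong> product_group {..<k} (\<lambda>_. integer_mod_group p)) \<and>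
      regular_on \<Omega> V)"

end

(* Let N be a minimal normal subgroup of G. It is transitive, and an abelian N is regular,
   elementary abelian and equal to the socle. If N is nonabelian, then its centralizer is
   trivial: otherwise the centralizer is transitive, so all nontrivial elements of N are
   derangements, and N is an r-group with a nontrivial centre. If N is moreover not simple,
   then N = S \<times> C for some normal subgroup S such that C contains a conjugate of S. Let T be a
   point stabilizer in N. If CT is a proper subgroup of N, Jordan's theorem gives some sc in no
   conjugate of CT, so the coset sC consists of derangements, and C consists of r-elements. If
   CT = N, then the intersection of S and T is normal in N, hence trivial, so S is semiregular and
   consists of r-elements. In both cases S is an r-group, and its nontrivial centre is central
   in N. Hence N is simple, and G embeds in Aut(N). *)
theory Submission
  imports Defs "HOL-Number_Theory.Cong"
begin

subsection \<open>Groups of prime power order and Jordan's theorem\<close>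

text \<open>The hypothesis says nothing about elements with fixed points, so each use of it must
  first produce many derangements at once: a semiregular subgroup, or a whole coset of a subgroup.
  The subgroup \<open>CT\<close> comes from the action of \<open>N\<close> on its cosets. This is a
  transitive image of the action on \<Omega>, so an element that fixes no coset is a derangement on
  \<Omega>; and \<open>C\<close> acts trivially there, so such an element may be multiplied by
  anything in \<open>C\<close>. If \<open>CT = N\<close>, the image is a single point, but then
  \<open>C\<close> is transitive and constrains the factor \<open>S\<close> that commutes with it. A
  coset \<open>sC\<close> of r-elements serves as well as a subgroup: \<open>S\<close> and
  \<open>C\<close> commute and meet trivially, so \<open>(s c)^(r^m) = 1\<close> forces
  \<open>s^(r^m) = c^(r^m) = 1\<close>. The two cases control different factors, and the conjugate
  of \<open>S\<close> inside \<open>C\<close> brings them back to \<open>S\<close>.\<close>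

context group begin

text \<open>By Cauchy's theorem every prime \<open>q\<close> dividing the order is the order of an
  element, and that order also divides a power of \<open>p\<close>.\<close>

lemma prime_pow_order_if_elements_prime_pow:
  assumes fin: "finite (carrier G)" and p: "Factorial_Ring.prime p"
    and elem: "\<And>x. x \<in> carrier G \<Longrightarrow> \<exists>m::nat. x [^] (p ^ m) = \<one>"
  shows "\<exists>n. order G = p ^ n"
proof -
  have ord_pos: "order G > 0" using fin by (simp add: order_gt_0_iff_finite)
  have only_p: "q = p" if q: "Factorial_Ring.prime q" "q dvd order G" for q
  proof (rule ccontr)
    assume "q \<noteq> p"
    \<comment> \<open>Exponent 1 turns Sylow's theorem into Cauchy's: \<open>m\<close> may still be
      divisible by \<open>q\<close>, and \<open>H\<close> has order exactly
      \<open>q\<close>.\<close>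
    obtain m where "order G = q ^ 1 * m" using q(2) by (auto elim: dvdE)
    then obtain H where H: "subgroup H G" "card H = q ^ 1"
      using sylow_thm[OF q(1) is_group _ fin] by blast
    have "H \<noteq> {\<one>}" using H(2) q(1) by (auto simp: prime_nat_iff)
    then obtain x where x: "x \<in> H" "x \<noteq> \<one>" using subgroup.one_closed[OF H(1)] by blast
    have xG: "x \<in> carrier G" using subgroup.mem_carrier[OF H(1) x(1)] .
    have "x [^]\<^bsub>G\<lparr>carrier := H\<rparr>\<^esub> order (G\<lparr>carrier := H\<rparr>) = \<one>"
      using group.pow_order_eq_1[OF subgroup_imp_group[OF H(1)], of x] x by simp
    then have "x [^] q = \<one>" using H(2) by (simp add: order_def nat_pow_consistent[symmetric])
    then have "ord x dvd q" using pow_eq_id[OF xG] by blast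
    moreover obtain m where "ord x dvd p ^ m" using elem[OF xG] pow_eq_id[OF xG] by blast
    moreover have "coprime q (p ^ m)" using \<open>q \<noteq> p\<close> p q(1) by (simp add: primes_coprime)
    ultimately have "ord x = 1"
      by (metis coprime_common_divisor nat_dvd_1_iff_1)
    then show False using ord_eq_1[OF xG] x by simp
  qed
  define a m where "a = multiplicity p (order G)" and "m = order G div p ^ a"
  have eq: "order G = p ^ a * m" unfolding a_def m_def by (simp add: multiplicity_dvd)
  have "m = 1"
  proof (rule ccontr)
    assume "m \<noteq> 1"
    then obtain q where q: "Factorial_Ring.prime q" "q dvd m" using prime_factor_nat by blast
    then have "p dvd m" using only_p eq by (metis dvd_mult)
    then show False using ord_pos p unfolding m_def a_def
      by (metis multiplicity_decompose not_less_iff_gr_or_eq not_prime_unit)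
  qed
  then show ?thesis using eq by auto
qed

end

text \<open>Orbit sizes divide \<open>p ^ n\<close>, so an orbit is either a single fixed point or
  has size 0 modulo \<open>p\<close>. The congruence is proved orbit by orbit and summed.\<close>

lemma (in group_action) card_cong_card_fixed_points:
  assumes "finite E" and "order G = p ^ n" and p: "Factorial_Ring.prime (p::nat)"
  shows "[card E = card {x \<in> E. \<forall>g\<in>carrier G. \<phi> g x = x}] (mod p)"
proof -
  interpret G: group G using group_hom group_hom.axioms(1) by auto
  let ?F = "{x \<in> E. \<forall>g\<in>carrier G. \<phi> g x = x}"
  let ?O = "orbits G E \<phi>"
  have finO: "finite ?O" unfolding orbits_def using assms(1) by auto
  have "[card orb = card (orb \<inter> ?F)] (mod p)" if orb: "orb \<in> ?O" for orb
  proof -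
    obtain x where x: "x \<in> E" "orb = orbit G \<phi> x" using orb unfolding orbits_def by auto
    have xo: "x \<in> orb" using x orbit_refl by simp
    show ?thesis
    proof (cases "card orb = 1")
      case True
      then have o: "orb = {x}" using xo by (metis card_1_singletonE singletonD)
      then have "\<phi> g x = x" if "g \<in> carrier G" for g
        using that x(2) unfolding orbit_def by blast
      then have "orb \<inter> ?F = orb" using o x by auto
      then show ?thesis by simp
    next
      case False
      have "y \<notin> ?F" if y: "y \<in> orb" for y
      proof
        assume yF: "y \<in> ?F"
        then have "orbit G \<phi> y = {y}" unfolding orbit_def using G.one_closed by force
        moreover have "x \<in> orbit G \<phi> y"  using orbit_sym[of x y] x y yF by auto
        ultimately have "orb = {y}" using x by simp
        then show False using False by simp
      qed
      then have "orb \<inter> ?F = {}" by blast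
      moreover have "card orb dvd p ^ n"
        using orbit_stabilizer_theorem[OF x(1)] x(2) assms(2) by (metis dvd_triv_left)
      then have "p dvd card orb"
        using False p by (metis divides_primepow_nat dvd_power neq0_conv power_0)
      ultimately show ?thesis by (simp add: cong_0_iff)
    qed
  qed
  then have "[(\<Sum>orb\<in>?O. card orb) = (\<Sum>orb\<in>?O. card (orb \<inter> ?F))] (mod p)"
    by (rule cong_sum)
  moreover have "(\<Sum>orb\<in>?O. card orb) = card E"
    using disjoint_sum[OF assms(1), of "\<lambda>_. 1::nat"] by simp
  moreover have "(\<Sum>orb\<in>?O. card (orb \<inter> ?F)) = card ?F"
  proof -
    have fo: "finite orb" if "orb \<in> ?O" for orb
      using that assms(1) orbits_coverture by (metis Union_upper finite_subset)
    have "(\<Sum>orb\<in>?O. card (orb \<inter> ?F)) = (\<Sum>orb\<in>?O. \<Sum>x\<in>orb. if x \<in> ?F then 1 else 0)"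
      by (intro sum.cong refl) (simp add: fo sum.If_cases del: mem_Collect_eq)
    also have "\<dots> = (\<Sum>x\<in>E. if x \<in> ?F then 1 else 0)" by (rule disjoint_sum[OF assms(1)])
    also have "\<dots> = card ?F"
    proof -
      have "E \<inter> ?F = ?F" by blast
      then show ?thesis using assms(1) by (simp add: sum.If_cases del: mem_Collect_eq)
    qed
    finally show ?thesis .
  qed
  ultimately show ?thesis by simp
qed

context group begin

text \<open>The fixed points of the conjugation action are the central elements. Their number is
  divisible by \<open>p\<close>, and it is positive because of \<open>\<one>\<close>, so there are
  at least \<open>p\<close> of them.\<close>

lemma prime_pow_order_imp_center_nontrivial:
  assumes p: "Factorial_Ring.prime p" and ord: "order G = p ^ n" and n: "carrier G \<noteq> {\<one>}"
  shows "\<exists>z\<in>carrier G. z \<noteq> \<one> \<and> (\<forall>g\<in>carrier G. g \<otimes> z = z \<otimes> g)"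
proof -
  interpret A: group_action G "carrier G" "\<lambda>g. \<lambda>h\<in>carrier G. g \<otimes> h \<otimes> inv g"
    by (rule action_by_conjugation)
  have fin: "finite (carrier G)"
    using ord p by (metis card.infinite not_prime_0 order_def power_not_zero)
  let ?F = "{x \<in> carrier G. \<forall>g\<in>carrier G. (\<lambda>h\<in>carrier G. g \<otimes> h \<otimes> inv g) x = x}"
  have "n \<noteq> 0"
  proof
    assume "n = 0"
    then have "card (carrier G) = 1" using ord by (simp add: order_def)
    then show False using n by (metis card_1_singletonE one_closed singletonD)
  qed
  then have "p dvd card (carrier G)" using ord by (simp add: order_def)
  then have "p dvd card ?F"
    using A.card_cong_card_fixed_points[OF fin ord p] by (metis (no_types, lifting) cong_dvd_iff)
  moreover have "\<one> \<in> ?F" by simp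
  moreover have "finite ?F" using fin by simp
  ultimately have "?F \<noteq> {\<one>}"
    using p by (metis (no_types, lifting) One_nat_def card.empty card.insert empty_iff
        finite.emptyI not_prime_unit nat_dvd_1_iff_1)
  then obtain z where z: "z \<in> ?F" "z \<noteq> \<one>" using \<open>\<one> \<in> ?F\<close> by blast
  have "g \<otimes> z = z \<otimes> g" if g: "g \<in> carrier G" for g
  proof -
    have "g \<otimes> z \<otimes> inv g = z" using z g by auto
    then show ?thesis using g z by (metis (no_types, lifting) inv_solve_right' m_closed mem_Collect_eq)
  qed
  then show ?thesis using z by blast
qed

text \<open>Jordan's theorem for the action on the cosets of \<open>H\<close>, by counting. There
  are at most \<open>|G : H|\<close> conjugates of \<open>H\<close>, with \<open>|H| - 1\<close>
  nontrivial elements each. Together they hold at most \<open>|G| - |G : H|\<close> elements, which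
  is less than \<open>|G| - 1\<close> since the index exceeds 1.\<close>

lemma ex_not_conjugate_into_proper_subgroup:
  assumes fin: "finite (carrier G)" and H: "subgroup H G" "H \<noteq> carrier G"
  shows "\<exists>x\<in>carrier G. \<forall>g\<in>carrier G. g \<otimes> x \<otimes> inv g \<notin> H"
proof (rule ccontr)
  assume "\<not> ?thesis"
  then have all: "\<And>x. x \<in> carrier G \<Longrightarrow> \<exists>g\<in>carrier G. g \<otimes> x \<otimes> inv g \<in> H" by blast
  have HG: "H \<subseteq> carrier G" using H subgroup.subset by blast
  have finH: "finite H" using HG fin finite_subset by blast
  \<comment> \<open>The conjugate \<open>g^-1 H g\<close> depends only on the coset
    \<open>H g\<close>, so an arbitrary representative of \<open>R\<close> is used and the
    conjugates are indexed by \<open>rcosets H\<close>.\<close>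
  define conj where "conj R = (let g = (SOME g. g \<in> R) in (\<lambda>h. inv g \<otimes> h \<otimes> g) ` (H - {\<one>}))" for R
  have "carrier G - {\<one>} \<subseteq> (\<Union>R\<in>rcosets H. conj R)"
  proof
    fix x assume x: "x \<in> carrier G - {\<one>}"
    then obtain g where g: "g \<in> carrier G" "g \<otimes> x \<otimes> inv g \<in> H" using all by blast
    \<comment> \<open>The representative selected in \<open>conj\<close> is some
      \<open>k = h g\<close> with \<open>h\<close> in \<open>H\<close>; it conjugates
      \<open>x\<close> into \<open>H\<close> because \<open>g\<close> does.\<close>
    define k where "k = (SOME k. k \<in> H #> g)"
    have "k \<in> H #> g" unfolding k_def
      using g H by (metis rcos_self someI_ex)
    then obtain h where h: "h \<in> H" "k = h \<otimes> g" unfolding r_coset_def by blast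
    then have hG: "h \<in> carrier G" using HG by blast
    have k: "k \<in> carrier G" using h hG g by simp
    have "k \<otimes> x \<otimes> inv k = h \<otimes> (g \<otimes> x \<otimes> inv g) \<otimes> inv h"
      using h hG g x by (simp add: inv_mult_group m_assoc)
    also have "\<dots> \<in> H" using h g H by (meson subgroup.m_closed subgroup.m_inv_closed)
    finally have kx: "k \<otimes> x \<otimes> inv k \<in> H" .
    have xe: "x = inv k \<otimes> (k \<otimes> x \<otimes> inv k) \<otimes> k" using k x by (simp add: m_assoc inv_solve_left)
    have "k \<otimes> x \<otimes> inv k \<noteq> \<one>"
      using k x xe by auto
    then have "x \<in> conj (H #> g)" unfolding conj_def Let_def k_def[symmetric] using kx xe by blast
    moreover have "H #> g \<in> rcosets H" using g HG by (simp add: rcosetsI)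
    ultimately show "x \<in> (\<Union>R\<in>rcosets H. conj R)" by blast
  qed
  moreover have finR: "finite (rcosets H)" using fin by (simp add: rcosets_finite RCOSETS_def)
  moreover have finC: "finite (conj R)" for R unfolding conj_def Let_def using finH by simp
  ultimately have "card (carrier G - {\<one>}) \<le> card (\<Union>R\<in>rcosets H. conj R)"
    by (meson card_mono finite_UN)
  also have "\<dots> \<le> (\<Sum>R\<in>rcosets H. card (conj R))" by (rule card_UN_le[OF finR])
  also have "\<dots> \<le> (\<Sum>R\<in>rcosets H. card H - 1)"
    by (intro sum_mono) (metis (no_types, lifting) conj_def card_Diff_singleton card_image_le finH
        finite_Diff subgroup.one_closed[OF H(1)])
  finally have le: "order G - 1 \<le> card (rcosets H) * (card H - 1)"
    using fin by (simp add: order_def)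
  have lag: "card (rcosets H) * card H = order G" using lagrange[OF H(1)] .
  have "card H < order G" unfolding order_def using H HG fin by (simp add: psubset_card_mono psubsetI)
  moreover have "card H > 0" using finH subgroup.one_closed[OF H(1)] card_gt_0_iff by blast
  ultimately have "card (rcosets H) > 1"
    using lag by (metis less_irrefl_nat less_one linorder_neqE_nat mult_0 mult_1 not_less_zero)
  moreover have "order G \<ge> card (rcosets H)"
    using lag \<open>card H > 0\<close> by (metis One_nat_def Suc_leI mult.right_neutral mult_le_mono2)
  moreover have "card (rcosets H) * (card H - 1) = order G - card (rcosets H)"
    unfolding lag[symmetric] by (simp only: diff_mult_distrib2 mult_1_right)
  ultimately show False using le by linarith
qed

end

subsection \<open>Conjugation and centralizers\<close>

definition conj_by :: "('a, 'b) monoid_scheme \<Rightarrow> 'a \<Rightarrow> 'a \<Rightarrow> 'a"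
  where "conj_by G g x = g \<otimes>\<^bsub>G\<^esub> x \<otimes>\<^bsub>G\<^esub> inv\<^bsub>G\<^esub> g"

definition centralizer :: "('a, 'b) monoid_scheme \<Rightarrow> 'a set \<Rightarrow> 'a set"
  where "centralizer G A = {g \<in> carrier G. \<forall>a\<in>A. g \<otimes>\<^bsub>G\<^esub> a = a \<otimes>\<^bsub>G\<^esub> g}"

context group begin

lemma inv_mult_cancel_left:
  assumes "g \<in> carrier G" "x \<in> carrier G"
  shows "inv g \<otimes> (g \<otimes> x) = x" "g \<otimes> (inv g \<otimes> x) = x"
  using assms by (simp_all flip: m_assoc)

lemma subgroup_nat_pow_closed: "\<lbrakk>subgroup H G; x \<in> H\<rbrakk> \<Longrightarrow> x [^] (n::nat) \<in> H"
  by (induction n) (simp_all add: subgroup.one_closed subgroup.m_closed)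

lemma conj_by_closed [simp]: "\<lbrakk>g \<in> carrier G; x \<in> carrier G\<rbrakk> \<Longrightarrow> conj_by G g x \<in> carrier G"
  by (simp add: conj_by_def)

lemma conj_by_mult:
  "\<lbrakk>g \<in> carrier G; x \<in> carrier G; y \<in> carrier G\<rbrakk>
   \<Longrightarrow> conj_by G g (x \<otimes> y) = conj_by G g x \<otimes> conj_by G g y"
  by (simp add: conj_by_def m_assoc inv_mult_cancel_left)

lemma conj_by_comp:
  "\<lbrakk>g \<in> carrier G; h \<in> carrier G; x \<in> carrier G\<rbrakk>
   \<Longrightarrow> conj_by G (g \<otimes> h) x = conj_by G g (conj_by G h x)"
  by (simp add: conj_by_def m_assoc inv_mult_group)

lemma conj_by_one [simp]: "x \<in> carrier G \<Longrightarrow> conj_by G \<one> x = x"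
  by (simp add: conj_by_def)

lemma conj_by_inv_cancel [simp]:
  assumes "g \<in> carrier G" "x \<in> carrier G"
  shows "conj_by G g (conj_by G (inv g) x) = x" "conj_by G (inv g) (conj_by G g x) = x"
  using assms by (simp_all flip: conj_by_comp)

lemma conj_by_hom: "g \<in> carrier G \<Longrightarrow> group_hom G G (conj_by G g)"
  by (simp add: group_hom_def group_hom_axioms_def hom_def conj_by_mult)

lemma conj_by_m_inv: "\<lbrakk>g \<in> carrier G; x \<in> carrier G\<rbrakk> \<Longrightarrow> conj_by G g (inv x) = inv (conj_by G g x)"
  using group_hom.hom_inv[OF conj_by_hom] .

lemma conj_by_pow:
  "\<lbrakk>g \<in> carrier G; x \<in> carrier G\<rbrakk> \<Longrightarrow> conj_by G g (x [^] (n::nat)) = conj_by G g x [^] n"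
  using group_hom.hom_nat_pow[OF conj_by_hom] .

lemma inj_on_conj_by: "g \<in> carrier G \<Longrightarrow> inj_on (conj_by G g) (carrier G)"
  by (metis conj_by_inv_cancel(2) inj_onI)

lemma conj_by_eq_iff_commute:
  "\<lbrakk>g \<in> carrier G; x \<in> carrier G\<rbrakk> \<Longrightarrow> conj_by G g x = x \<longleftrightarrow> g \<otimes> x = x \<otimes> g"
  unfolding conj_by_def by (metis inv_solve_right' m_closed)

lemma normal_conj_by_iff:
  "N \<lhd> G \<longleftrightarrow> subgroup N G \<and> (\<forall>g\<in>carrier G. \<forall>x\<in>N. conj_by G g x \<in> N)"
  unfolding normal_inv_iff conj_by_def by simp

text \<open>Lets normality inside \<open>N\<close> be handled with the operations of
  \<open>G\<close>, so that conjugation by elements of \<open>N\<close> and of \<open>G\<close> can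
  be mixed.\<close>

lemma normal_in_subgroup_iff:
  assumes "subgroup N G"
  shows "S \<lhd> G\<lparr>carrier := N\<rparr> \<longleftrightarrow>
    subgroup S G \<and> S \<subseteq> N \<and> (\<forall>n\<in>N. \<forall>s\<in>S. conj_by G n s \<in> S)"
proof -
  interpret H: group "G\<lparr>carrier := N\<rparr>" by (rule subgroup_imp_group[OF assms])
  have "subgroup S (G\<lparr>carrier := N\<rparr>) \<longleftrightarrow> subgroup S G \<and> S \<subseteq> N"
  proof
    assume "subgroup S (G\<lparr>carrier := N\<rparr>)"
    then show "subgroup S G \<and> S \<subseteq> N"
      using incl_subgroup[OF assms] subgroup.subset[of S "G\<lparr>carrier := N\<rparr>"] by simp
  next
    assume "subgroup S G \<and> S \<subseteq> N"
    then show "subgroup S (G\<lparr>carrier := N\<rparr>)" using subgroup_incl[OF _ assms] by blast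
  qed
  then show ?thesis
    unfolding H.normal_conj_by_iff using assms by (auto simp: conj_by_def m_inv_consistent)
qed

lemma centralizer_subset: "centralizer G A \<subseteq> carrier G"
  by (auto simp: centralizer_def)

text \<open>Conjugation by \<open>g\<close> turns the relation between \<open>c\<close> and
  \<open>g^-1 a g\<close> into the one between \<open>g c g^-1\<close> and \<open>a\<close>; hence
  the hypothesis on \<open>inv g\<close>.\<close>

lemma conj_by_mem_centralizer:
  assumes c: "c \<in> centralizer G A" and g: "g \<in> carrier G" and A: "A \<subseteq> carrier G"
    and inv: "\<And>a. a \<in> A \<Longrightarrow> conj_by G (inv g) a \<in> A"
  shows "conj_by G g c \<in> centralizer G A"
proof -
  have "conj_by G g c \<otimes> a = a \<otimes> conj_by G g c" if a: "a \<in> A" for a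
  proof -
    have "c \<otimes> conj_by G (inv g) a = conj_by G (inv g) a \<otimes> c"
      using c inv[OF a] by (simp add: centralizer_def)
    then have "conj_by G g (c \<otimes> conj_by G (inv g) a) = conj_by G g (conj_by G (inv g) a \<otimes> c)"
      by simp
    then show ?thesis
      using g a A c by (simp add: conj_by_mult centralizer_def subset_iff)
  qed
  then show ?thesis using c g by (simp add: centralizer_def)
qed

lemma subgroup_centralizer:
  assumes "A \<subseteq> carrier G"
  shows "subgroup (centralizer G A) G"
proof (rule subgroupI)
  show "centralizer G A \<noteq> {}" using assms by (auto simp: centralizer_def intro!: exI[of _ \<one>])
  show "inv x \<in> centralizer G A" if x: "x \<in> centralizer G A" for x
  proof -
    have "inv x \<otimes> a = a \<otimes> inv x" if a: "a \<in> A" for a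
    proof -
      have G: "x \<in> carrier G" "a \<in> carrier G" using x a assms by (auto simp: centralizer_def)
      have "conj_by G x a = a"
        using x a conj_by_eq_iff_commute[OF G] by (simp add: centralizer_def)
      then have "conj_by G (inv x) a = a" using conj_by_inv_cancel(2)[OF G] by simp
      then show ?thesis using conj_by_eq_iff_commute G by simp
    qed
    then show ?thesis using x by (simp add: centralizer_def)
  qed
  show "x \<otimes> y \<in> centralizer G A" if xy: "x \<in> centralizer G A" "y \<in> centralizer G A" for x y
  proof -
    have "(x \<otimes> y) \<otimes> a = a \<otimes> (x \<otimes> y)" if a: "a \<in> A" for a
    proof -
      have G: "x \<in> carrier G" "y \<in> carrier G" "a \<in> carrier G"
        using xy a assms by (auto simp: centralizer_def)
      have "conj_by G x a = a" "conj_by G y a = a"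
        using xy a G by (simp_all add: conj_by_eq_iff_commute centralizer_def)
      then have "conj_by G (x \<otimes> y) a = a" using G by (simp add: conj_by_comp)
      then show ?thesis using conj_by_eq_iff_commute[OF m_closed[OF G(1,2)] G(3)] by simp
    qed
    then show ?thesis using xy by (simp add: centralizer_def)
  qed
qed (rule centralizer_subset)

lemma mem_centralizer_set_mult:
  assumes A: "A \<subseteq> carrier G" and B: "B \<subseteq> carrier G"
    and z: "z \<in> centralizer G A" "z \<in> centralizer G B"
  shows "z \<in> centralizer G (A <#> B)"
proof -
  have zG: "z \<in> carrier G" using z by (simp add: centralizer_def)
  have "z \<otimes> (a \<otimes> b) = (a \<otimes> b) \<otimes> z" if ab: "a \<in> A" "b \<in> B" for a b
  proof -
    have G: "a \<in> carrier G" "b \<in> carrier G" using ab A B by auto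
    have "conj_by G z a = a" "conj_by G z b = b"
      using ab z zG G by (simp_all add: conj_by_eq_iff_commute centralizer_def)
    then show ?thesis using zG G conj_by_eq_iff_commute[of z "a \<otimes> b"] by (simp add: conj_by_mult)
  qed
  then show ?thesis using zG by (auto simp: centralizer_def set_mult_def)
qed

lemma normal_centralizer:
  assumes "N \<lhd> G"
  shows "centralizer G N \<lhd> G"
proof -
  have N: "N \<subseteq> carrier G" "\<And>g x. \<lbrakk>g \<in> carrier G; x \<in> N\<rbrakk> \<Longrightarrow> conj_by G g x \<in> N"
    using assms subgroup.subset unfolding normal_conj_by_iff by auto
  then show ?thesis
    unfolding normal_conj_by_iff
    using subgroup_centralizer[OF N(1)] conj_by_mem_centralizer[OF _ _ N(1)] by auto
qed

text \<open>The commutator \<open>s t s^-1 t^-1\<close> lies in \<open>T\<close> when read as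
  \<open>(s t s^-1) t^-1\<close> and in \<open>S\<close> when read as
  \<open>s (t s^-1 t^-1)\<close>.\<close>

lemma commute_if_normalize_inter_trivial:
  assumes S: "subgroup S G" and T: "subgroup T G" and inter: "S \<inter> T = {\<one>}"
    and ST: "\<And>s t. \<lbrakk>s \<in> S; t \<in> T\<rbrakk> \<Longrightarrow> conj_by G s t \<in> T"
    and TS: "\<And>s t. \<lbrakk>s \<in> S; t \<in> T\<rbrakk> \<Longrightarrow> conj_by G t s \<in> S"
    and s: "s \<in> S" and t: "t \<in> T"
  shows "s \<otimes> t = t \<otimes> s"
proof -
  have G: "s \<in> carrier G" "t \<in> carrier G"
    using subgroup.mem_carrier[OF S s] subgroup.mem_carrier[OF T t] .
  have "conj_by G s t \<otimes> inv t \<in> T"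
    using ST s t T by (simp add: subgroup.m_closed subgroup.m_inv_closed)
  moreover have "conj_by G s t \<otimes> inv t = s \<otimes> conj_by G t (inv s)"
    using G by (simp add: conj_by_def m_assoc)
  moreover have "s \<otimes> conj_by G t (inv s) \<in> S"
    using TS s t S by (simp add: subgroup.m_closed subgroup.m_inv_closed)
  ultimately have "conj_by G s t \<otimes> inv t = \<one>" using inter by auto
  then have "conj_by G s t = t"
    using G by (metis conj_by_closed inv_closed inv_equality inv_inv)
  then show ?thesis using G conj_by_eq_iff_commute by simp
qed

subsection \<open>Minimal normal subgroups\<close>

text \<open>The centre of \<open>N\<close> is \<open>N \<inter> centralizer G N\<close>, which is
  normal in \<open>G\<close>; once nontrivial, it is all of \<open>N\<close> by minimality.\<close>

lemma minimal_normal_comm_if_center_nontrivial: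
  assumes min: "minimal_normal N G" and z: "z \<in> N" "z \<noteq> \<one>" "z \<in> centralizer G N"
  shows "comm_group (G\<lparr>carrier := N\<rparr>)"
proof -
  have N: "N \<lhd> G" using min by (simp add: minimal_normal_def)
  have "N \<inter> centralizer G N \<lhd> G"
    using N normal_centralizer by (simp add: normal_subgroup_intersect)
  then have "N \<inter> centralizer G N = N"
    using min z unfolding minimal_normal_def by blast
  then have "x \<otimes> y = y \<otimes> x" if "x \<in> N" "y \<in> N" for x y
    using that unfolding centralizer_def by blast
  then show ?thesis
    using N normal_imp_subgroup subgroup_imp_group group.group_comm_groupI
    by (metis (no_types, lifting) monoid.select_convs(1) monoid.surjective
        partial_object.select_convs(1) partial_object.surjective partial_object.update_convs(1))
qed

lemma ex_center_if_elements_prime_pow: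
  fixes p :: nat
  assumes fin: "finite (carrier G)" and p: "Factorial_Ring.prime p" and S: "subgroup S G" "S \<noteq> {\<one>}"
    and elem: "\<And>x. x \<in> S \<Longrightarrow> \<exists>m::nat. x [^] (p ^ m) = \<one>"
  shows "\<exists>z\<in>S. z \<noteq> \<one> \<and> z \<in> centralizer G S"
proof -
  interpret H: group "G\<lparr>carrier := S\<rparr>" by (rule subgroup_imp_group[OF S(1)])
  have SG: "S \<subseteq> carrier G" using S subgroup.subset by blast
  have "\<exists>n. order (G\<lparr>carrier := S\<rparr>) = p ^ n"
  proof (rule H.prime_pow_order_if_elements_prime_pow[OF _ p])
    show "finite (carrier (G\<lparr>carrier := S\<rparr>))" using fin SG finite_subset by auto
    show "\<exists>m. x [^]\<^bsub>G\<lparr>carrier := S\<rparr>\<^esub> p ^ m = \<one>\<^bsub>G\<lparr>carrier := S\<rparr>\<^esub>"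
      if "x \<in> carrier (G\<lparr>carrier := S\<rparr>)" for x
      using elem that by (simp add: nat_pow_consistent[symmetric])
  qed
  then obtain n where "order (G\<lparr>carrier := S\<rparr>) = p ^ n" ..
  from H.prime_pow_order_imp_center_nontrivial[OF p this] show ?thesis
    using S SG by (auto simp: centralizer_def)
qed

lemma minimal_normal_comm_if_elements_prime_pow:
  fixes p :: nat
  assumes "finite (carrier G)" "Factorial_Ring.prime p" and min: "minimal_normal N G"
    and "\<And>x. x \<in> N \<Longrightarrow> \<exists>m::nat. x [^] (p ^ m) = \<one>"
  shows "comm_group (G\<lparr>carrier := N\<rparr>)"
proof -
  have "subgroup N G" "N \<noteq> {\<one>}" using min by (auto simp: minimal_normal_def normal_imp_subgroup)
  then show ?thesis
    using ex_center_if_elements_prime_pow[OF assms(1,2) _ _ assms(4)]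
      minimal_normal_comm_if_center_nontrivial[OF min] by blast
qed

text \<open>\<open>C\<close> is the centralizer of \<open>S\<close> in \<open>N\<close>, and every
  \<open>G\<close>-conjugate of \<open>S\<close> either equals \<open>S\<close> or lies in
  \<open>C\<close>. If all of them were equal to \<open>S\<close>, then \<open>S\<close> would be
  normal in \<open>G\<close>, hence equal to \<open>N\<close>, and the least order of
  \<open>S\<close> would make \<open>N\<close> simple. So some conjugate lies in
  \<open>C\<close>.\<close>

lemma minimal_normal_decomposition:
  assumes fin: "finite (carrier G)" and min: "minimal_normal N G"
    and ncomm: "\<not> comm_group (G\<lparr>carrier := N\<rparr>)" and nsimple: "\<not> simple_group (G\<lparr>carrier := N\<rparr>)"
  obtains S C g where "S \<lhd> G\<lparr>carrier := N\<rparr>" "S \<noteq> {\<one>}" "C \<lhd> G\<lparr>carrier := N\<rparr>"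
    "S \<inter> C = {\<one>}" "\<And>s c. \<lbrakk>s \<in> S; c \<in> C\<rbrakk> \<Longrightarrow> s \<otimes> c = c \<otimes> s" "S <#> C = N"
    "g \<in> carrier G" "conj_by G g ` S \<subseteq> C"
proof -
  have N: "N \<lhd> G" "N \<noteq> {\<one>}"
    and Nmin: "\<And>M. \<lbrakk>M \<lhd> G; M \<subseteq> N\<rbrakk> \<Longrightarrow> M = {\<one>} \<or> M = N"
    using min by (auto simp: minimal_normal_def)
  have Nsub: "subgroup N G" using N normal_imp_subgroup by blast
  have NG: "N \<subseteq> carrier G" using Nsub subgroup.subset by blast
  have finN: "finite N" using NG fin finite_subset by blast
  have Nconj: "conj_by G g x \<in> N" if "g \<in> carrier G" "x \<in> N" for g x
    using N(1) that unfolding normal_conj_by_iff by blast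
  interpret H: group "G\<lparr>carrier := N\<rparr>" by (rule subgroup_imp_group[OF Nsub])
  note normN = normal_in_subgroup_iff[OF Nsub]
  \<comment> \<open>A nontrivial normal subgroup of \<open>N\<close> of least order meets each of its other
    \<open>G\<close>-conjugates trivially, hence commutes with it.\<close>
  define P where "P T \<longleftrightarrow> T \<lhd> G\<lparr>carrier := N\<rparr> \<and> T \<noteq> {\<one>}" for T
  have "N \<lhd> G\<lparr>carrier := N\<rparr>" unfolding normN using Nsub Nconj NG by auto
  then have "P N" using N P_def by blast
  then obtain S where S: "P S" and Sleast: "\<And>T. P T \<Longrightarrow> card S \<le> card T"
    using ex_has_least_nat[of P N card] by blast
  have Sn: "S \<lhd> G\<lparr>carrier := N\<rparr>" and Snt: "S \<noteq> {\<one>}" using S P_def by auto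
  have Ssub: "subgroup S G" and SN: "S \<subseteq> N"
    and Sconj: "\<And>n s. \<lbrakk>n \<in> N; s \<in> S\<rbrakk> \<Longrightarrow> conj_by G n s \<in> S"
    using Sn unfolding normN by auto
  have SG: "S \<subseteq> carrier G" using SN NG by blast
  have finS: "finite S" using SN finN finite_subset by blast
  define C where "C = N \<inter> centralizer G S"
  have Csub: "subgroup C G"
    unfolding C_def using subgroups_Inter_pair[OF Nsub subgroup_centralizer[OF SG]] .
  have comm: "s \<otimes> c = c \<otimes> s" if "s \<in> S" "c \<in> C" for s c
    using that unfolding C_def centralizer_def by simp
  have Cn: "C \<lhd> G\<lparr>carrier := N\<rparr>"
    unfolding normN
  proof (intro conjI ballI)
    show "subgroup C G" "C \<subseteq> N" using Csub C_def by auto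
    fix n c assume n: "n \<in> N" and c: "c \<in> C"
    have "conj_by G n c \<in> centralizer G S"
      using n c NG SG Sconj subgroup.m_inv_closed[OF Nsub n]
      by (intro conj_by_mem_centralizer) (auto simp: C_def)
    then show "conj_by G n c \<in> C" using n c Nconj NG by (auto simp: C_def)
  qed
  have conj_S: "conj_by G g ` S = S \<or> conj_by G g ` S \<subseteq> C" if g: "g \<in> carrier G" for g
  proof (cases "conj_by G g ` S = S")
    case False
    let ?T = "conj_by G g ` S"
    have Tsub: "subgroup ?T G"
      using group_hom.subgroup_img_is_subgroup[OF conj_by_hom[OF g] Ssub] .
    have TN: "?T \<subseteq> N" using Nconj g SN by blast
    have cardT: "card ?T = card S"
      using card_image inj_on_subset[OF inj_on_conj_by[OF g] SG] by blast
    \<comment> \<open>Conjugating \<open>g s g^-1\<close> by \<open>n\<close> is the same as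
      conjugating \<open>s\<close> by \<open>g^-1 n g\<close> and then by \<open>g\<close>;
      normality of \<open>N\<close> keeps \<open>g^-1 n g\<close> in \<open>N\<close>, under which
      \<open>S\<close> is invariant.\<close>
    have Tconj: "conj_by G n t \<in> ?T" if n: "n \<in> N" and t: "t \<in> ?T" for n t
    proof -
      obtain s where s: "s \<in> S" "t = conj_by G g s" using t by blast
      have G: "n \<in> carrier G" "s \<in> carrier G" using n s NG SG by auto
      have "conj_by G (inv g) n \<in> N" using Nconj g n by simp
      then have "conj_by G (conj_by G (inv g) n) s \<in> S" using Sconj s by blast
      moreover have "conj_by G g (conj_by G (conj_by G (inv g) n) s) = conj_by G n t"
        unfolding s(2) using G g
        by (simp add: conj_by_def m_assoc inv_mult_group inv_mult_cancel_left)
      ultimately show ?thesis by (metis imageI)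
    qed
    have ST: "S \<inter> ?T = {\<one>}"
    proof (rule ccontr)
      assume "S \<inter> ?T \<noteq> {\<one>}"
      then have "P (S \<inter> ?T)"
        unfolding P_def normN using subgroups_Inter_pair[OF Ssub Tsub] SN Sconj Tconj by auto
      then have "card S \<le> card (S \<inter> ?T)" by (rule Sleast)
      then have "S \<inter> ?T = S" using finS by (simp add: card_seteq)
      then have "S = ?T" using cardT finS by (metis card_subset_eq finite_imageI inf.cobounded2)
      then show False using False by simp
    qed
    have ST_comm: "s \<otimes> t = t \<otimes> s" if "s \<in> S" "t \<in> ?T" for s t
      using commute_if_normalize_inter_trivial[OF Ssub Tsub ST _ _ that] SN TN Tconj Sconj by blast
    have "t \<in> C" if t: "t \<in> ?T" for t
    proof -
      have "t \<in> N" using t TN by blast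
      moreover have "\<forall>s\<in>S. t \<otimes> s = s \<otimes> t" using ST_comm[OF _ t] by simp
      ultimately show ?thesis using NG unfolding C_def centralizer_def by blast
    qed
    then show ?thesis by blast
  qed simp
  have SCsub: "subgroup (S <#> C) G"
  proof -
    have "subgroup (S <#>\<^bsub>G\<lparr>carrier := N\<rparr>\<^esub> C) (G\<lparr>carrier := N\<rparr>)"
      using H.mult_norm_subgroup[OF Sn] Cn normal_imp_subgroup by blast
    then show ?thesis using incl_subgroup[OF Nsub] by (simp add: set_mult_def)
  qed
  have S_SC: "S \<subseteq> S <#> C" "C \<subseteq> S <#> C"
    using subgroup.one_closed[OF Csub] subgroup.one_closed[OF Ssub] SG subgroup.subset[OF Csub]
    by (force simp: set_mult_def)+
  have SC: "S <#> C = N"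
  proof
    show "S <#> C \<subseteq> N" using SN subgroup.m_closed[OF Nsub] by (auto simp: set_mult_def C_def)
    \<comment> \<open>The normal core of \<open>SC\<close> in \<open>G\<close> contains \<open>S\<close>, so it is all of \<open>N\<close>.\<close>
    define K where "K = {n \<in> N. \<forall>g\<in>carrier G. conj_by G g n \<in> S <#> C}"
    have KG: "K \<subseteq> carrier G" using NG by (auto simp: K_def)
    have SK: "S \<subseteq> K"
    proof -
      have "conj_by G g s \<in> S <#> C" if "s \<in> S" "g \<in> carrier G" for s g
        using conj_S[OF that(2)] imageI[OF that(1), of "conj_by G g"] S_SC by blast
      then show ?thesis using SN by (auto simp: K_def)
    qed
    have "subgroup K G"
    proof (rule subgroupI[OF KG])
      show "K \<noteq> {}" using SK subgroup.one_closed[OF Ssub] by blast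
      show "inv a \<in> K" if "a \<in> K" for a
        using that KG subgroup.m_inv_closed[OF SCsub] subgroup.m_inv_closed[OF Nsub]
        by (auto simp: K_def conj_by_m_inv subset_iff)
      show "a \<otimes> b \<in> K" if "a \<in> K" "b \<in> K" for a b
        using that KG subgroup.m_closed[OF SCsub] subgroup.m_closed[OF Nsub]
        by (auto simp: K_def conj_by_mult subset_iff)
    qed
    moreover have "conj_by G g x \<in> K" if "g \<in> carrier G" "x \<in> K" for g x
      using that Nconj KG by (auto simp: K_def subset_iff simp flip: conj_by_comp)
    ultimately have "K \<lhd> G" unfolding normal_conj_by_iff by blast
    moreover have "K \<noteq> {\<one>}" using SK Snt subgroup.one_closed[OF Ssub] by blast
    ultimately have "K = N" using Nmin[of K] by (auto simp: K_def)
    then have "conj_by G \<one> n \<in> S <#> C" if "n \<in> N" for n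
      using that unfolding K_def by blast
    then show "N \<subseteq> S <#> C" using NG by (auto simp: subset_iff)
  qed
  \<comment> \<open>A common element commutes with \<open>S\<close> as a member of \<open>C\<close>
    and with \<open>C\<close> as a member of \<open>S\<close>, so it is central in
    \<open>SC = N\<close>, and a nonabelian \<open>N\<close> has trivial centre.\<close>
  have SC1: "S \<inter> C = {\<one>}"
  proof (rule ccontr)
    assume "S \<inter> C \<noteq> {\<one>}"
    then obtain z where z: "z \<in> S" "z \<in> C" "z \<noteq> \<one>"
      using subgroup.one_closed[OF Ssub] subgroup.one_closed[OF Csub] by blast
    have zG: "z \<in> carrier G" using z SG by blast
    have "z \<in> centralizer G S" using z C_def by blast
    moreover have "z \<in> centralizer G C" using comm[OF z(1)] zG by (simp add: centralizer_def)
    ultimately have "z \<in> centralizer G N"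
      using mem_centralizer_set_mult[OF SG subgroup.subset[OF Csub]] SC by blast
    then show False using minimal_normal_comm_if_center_nontrivial[OF min _ z(3)] z SN ncomm by blast
  qed
  have "\<exists>g\<in>carrier G. conj_by G g ` S \<subseteq> C"
  proof (rule ccontr)
    assume "\<not> ?thesis"
    then have "conj_by G g ` S = S" if "g \<in> carrier G" for g using conj_S that by blast
    then have "S \<lhd> G" unfolding normal_conj_by_iff using Ssub by blast
    then have "S = N" using Nmin[of S] SN Snt by blast
    have "simple_group (G\<lparr>carrier := N\<rparr>)"
    proof
      have "N - {\<one>} \<noteq> {}" using N(2) subgroup.one_closed[OF Nsub] by blast
      then have "card (N - {\<one>}) > 0" using finN by (simp add: card_gt_0_iff)
      then show "1 < order (G\<lparr>carrier := N\<rparr>)"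
        using subgroup.one_closed[OF Nsub] finN by (simp add: order_def)
      show "M = carrier (G\<lparr>carrier := N\<rparr>) \<or> M = {\<one>\<^bsub>G\<lparr>carrier := N\<rparr>\<^esub>}"
        if M: "M \<lhd> G\<lparr>carrier := N\<rparr>" for M
      proof (cases "M = {\<one>}")
        case False
        then have "card N \<le> card M" using Sleast[of M] M \<open>S = N\<close> by (simp add: P_def)
        moreover have "M \<subseteq> N" using M normN by blast
        ultimately show ?thesis using finN by (simp add: card_seteq)
      qed simp
    qed
    then show False using nsimple by blast
  qed
  then show ?thesis using that[OF Sn Snt Cn SC1 comm SC] by blast
qed

end

text \<open>The elements of \<open>N\<close> killed by \<open>p\<close> form a subgroup because
  \<open>N\<close> is abelian, and it is normal in \<open>G\<close> because conjugation respects
  powers. Choosing \<open>p\<close> among the prime divisors of the order of some element makes it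
  nontrivial, witnessed by \<open>y\<close> of order \<open>p\<close>.\<close>

lemma (in group) minimal_normal_comm_exponent_prime:
  assumes fin: "finite (carrier G)" and min: "minimal_normal N G"
    and comm: "comm_group (G\<lparr>carrier := N\<rparr>)"
  shows "\<exists>p::nat. Factorial_Ring.prime p \<and> (\<forall>x\<in>N. x [^] p = \<one>)"
proof -
  have N: "N \<lhd> G" "N \<noteq> {\<one>}"
    and Nmin: "\<And>M. \<lbrakk>M \<lhd> G; M \<subseteq> N\<rbrakk> \<Longrightarrow> M = {\<one>} \<or> M = N"
    using min by (auto simp: minimal_normal_def)
  have Nsub: "subgroup N G" using N normal_imp_subgroup by blast
  have NG: "\<And>x. x \<in> N \<Longrightarrow> x \<in> carrier G" using Nsub subgroup.subset by blast
  have Ncomm: "x \<otimes> y = y \<otimes> x" if "x \<in> N" "y \<in> N" for x y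
    using comm_monoid.m_comm[OF comm_group.axioms(1)[OF comm]] that by simp
  obtain x where x: "x \<in> N" "x \<noteq> \<one>" using N(2) subgroup.one_closed[OF Nsub] by blast
  have "ord x \<noteq> 1" using ord_eq_1[OF NG[OF x(1)]] x(2) by simp
  then obtain p where p: "Factorial_Ring.prime p" "p dvd ord x" using prime_factor_nat by blast
  define y where "y = x [^] (ord x div p)"
  have yN: "y \<in> N" unfolding y_def using subgroup_nat_pow_closed[OF Nsub x(1)] .
  have "ord x > 0" using ord_ge_1[OF fin NG[OF x(1)]] by simp
  then have "0 < ord x div p" "ord x div p < ord x"
    using p prime_gt_1_nat[OF p(1)] by (auto simp: dvd_imp_le div_greater_zero_iff prime_gt_0_nat)
  then have y1: "y \<noteq> \<one>"
    unfolding y_def using pow_eq_id[OF NG[OF x(1)]] by (auto dest: dvd_imp_le)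
  have yp: "y [^] p = \<one>" unfolding y_def using NG[OF x(1)] p by (simp add: nat_pow_pow)
  define M where "M = {x \<in> N. x [^] p = \<one>}"
  have "subgroup M G"
  proof (rule subgroupI)
    show "M \<subseteq> carrier G" "M \<noteq> {}" using NG yN yp by (auto simp: M_def)
    show "inv a \<in> M" if "a \<in> M" for a
      using that NG subgroup.m_inv_closed[OF Nsub] by (simp add: M_def nat_pow_inv)
    show "a \<otimes> b \<in> M" if "a \<in> M" "b \<in> M" for a b
      using that NG subgroup.m_closed[OF Nsub] Ncomm by (simp add: M_def pow_mult_distrib)
  qed
  moreover have "conj_by G g x \<in> M" if "g \<in> carrier G" "x \<in> M" for g x
  proof -
    have "conj_by G g x \<in> N" using N(1) that unfolding normal_conj_by_iff M_def by blast
    moreover have "conj_by G g x [^] p = conj_by G g (x [^] p)"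
      using that NG conj_by_pow[of g x p] by (simp only: M_def mem_Collect_eq)
    ultimately show ?thesis using that by (simp add: M_def conj_by_def)
  qed
  ultimately have "M \<lhd> G" unfolding normal_conj_by_iff by blast
  then have "M = N" using Nmin[of M] yN yp y1 by (auto simp: M_def)
  then show ?thesis using p(1) by (auto simp: M_def)
qed

lemma (in group) ex_minimal_normal:
  assumes fin: "finite (carrier G)" and nontriv: "carrier G \<noteq> {\<one>}"
  shows "\<exists>N. minimal_normal N G"
proof -
  define P where "P N \<longleftrightarrow> N \<lhd> G \<and> N \<noteq> {\<one>}" for N
  have "carrier G \<lhd> G" unfolding normal_conj_by_iff using subgroup_self by simp
  then have "P (carrier G)" using nontriv P_def by blast
  then obtain N where N: "P N" "\<And>M. P M \<Longrightarrow> card N \<le> card M"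
    using ex_has_least_nat[of P "carrier G" card] by blast
  have "finite N"
    using N(1) fin normal_imp_subgroup subgroup.subset finite_subset unfolding P_def by metis
  then have "M = N" if "M \<lhd> G" "M \<subseteq> N" "M \<noteq> {\<one>}" for M
    using N(2)[of M] that by (simp add: P_def card_seteq)
  then show ?thesis using N(1) unfolding minimal_normal_def P_def by blast
qed

subsection \<open>Transitive actions of direct products\<close>

text \<open>If \<open>h\<close> fixes \<open>x\<close>, this says that \<open>g h g^-1\<close> fixes
  \<open>g x\<close>: it is the tool for moving fixed points along the transitive action.\<close>

lemma (in group_action) action_conj_by:
  assumes "x \<in> E" "g \<in> carrier G" "h \<in> carrier G"
  shows "\<phi> (conj_by G g h) (\<phi> g x) = \<phi> g (\<phi> h x)"
proof -
  interpret G: group G using group_hom group_hom.axioms(1) by blast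
  have "\<phi> (conj_by G g h) (\<phi> g x) = \<phi> (conj_by G g h \<otimes> g) x"
    using assms composition_rule by simp
  also have "conj_by G g h \<otimes> g = g \<otimes> h" using assms by (simp add: conj_by_def G.m_assoc)
  finally show ?thesis using assms composition_rule by simp
qed

text \<open>The acting group will be the minimal normal subgroup. Primitivity need not pass to it,
  but transitivity and faithfulness do.\<close>

lemma (in transitive_action) factor_elements_prime_pow:
  fixes r :: nat
  assumes fin: "finite (carrier G)" and ne: "E \<noteq> {}"
    and faithful: "\<And>g. \<lbrakk>g \<in> carrier G; \<forall>x\<in>E. \<phi> g x = x\<rbrakk> \<Longrightarrow> g = \<one>"
    and der: "\<And>g. \<lbrakk>g \<in> carrier G; \<forall>x\<in>E. \<phi> g x \<noteq> x\<rbrakk> \<Longrightarrow> \<exists>m. g [^] (r ^ m) = \<one>"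
    and S: "S \<lhd> G" and C: "C \<lhd> G" and SC1: "S \<inter> C = {\<one>}" and SC: "S <#> C = carrier G"
    and comm: "\<And>s c. \<lbrakk>s \<in> S; c \<in> C\<rbrakk> \<Longrightarrow> s \<otimes> c = c \<otimes> s"
  shows "(\<forall>s\<in>S. \<exists>m. s [^] (r ^ m) = \<one>) \<or> (\<forall>c\<in>C. \<exists>m. c [^] (r ^ m) = \<one>)"
proof -
  interpret G: group G using group_hom group_hom.axioms(1) by blast
  have Ssub: "subgroup S G" and Csub: "subgroup C G" using S C normal_imp_subgroup by auto
  have SG: "\<And>s. s \<in> S \<Longrightarrow> s \<in> carrier G" and CG: "\<And>c. c \<in> C \<Longrightarrow> c \<in> carrier G"
    using Ssub Csub subgroup.subset by blast+
  obtain x where x: "x \<in> E" using ne by blast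
  define T where "T = stabilizer G \<phi> x"
  have Tsub: "subgroup T G" unfolding T_def using x by (rule stabilizer_subgroup)
  have TG: "\<And>t. t \<in> T \<Longrightarrow> t \<in> carrier G" using Tsub subgroup.subset by blast
  have CT: "subgroup (C <#> T) G" using G.mult_norm_subgroup[OF C Tsub] .
  show ?thesis
  proof (cases "C <#> T = carrier G")
    case True
    \<comment> \<open>Here \<open>C\<close> is transitive. Write \<open>h = c t\<close>: since
      \<open>c\<close> commutes with \<open>s\<close>, the conjugate \<open>h^-1 s h\<close> equals
      \<open>t^-1 s t\<close>, which fixes \<open>x\<close> because \<open>s\<close> and
      \<open>t\<close> do. So \<open>s\<close> fixes every point \<open>h x\<close>.\<close>
    have stab1: "s = \<one>" if s: "s \<in> S" "\<phi> s x = x" for s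
    proof (rule faithful)
      show sG: "s \<in> carrier G" using s SG by blast
      show "\<forall>z\<in>E. \<phi> s z = z"
      proof
        fix z assume "z \<in> E"
        then obtain h where h: "h \<in> carrier G" "\<phi> h x = z" using unique_orbit x by blast
        then obtain c t where ct: "c \<in> C" "t \<in> T" "h = c \<otimes> t"
          using True[symmetric] unfolding set_mult_def by blast
        have G: "c \<in> carrier G" "t \<in> carrier G" using ct CG TG by auto
        have tx: "\<phi> t x = x" using ct by (simp add: T_def stabilizer_def)
        have txi: "\<phi> (inv t) x = x" using orbit_sym_aux[OF G(2) x tx] .
        have "conj_by G c s = s" using G.conj_by_eq_iff_commute[OF G(1) sG] comm s ct by simp
        then have "conj_by G h (conj_by G (inv t) s) = s"
          using G sG ct by (simp add: G.conj_by_comp)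
        then have "\<phi> s z = \<phi> h (\<phi> (conj_by G (inv t) s) x)"
          using action_conj_by[OF x h(1), of "conj_by G (inv t) s"] h G sG by simp
        also have "\<phi> (conj_by G (inv t) s) x = x"
          using action_conj_by[OF x, of "inv t" s] txi s G sG by simp
        finally show "\<phi> s z = z" using h by simp
      qed
    qed
    have "\<exists>m. s [^] (r ^ m) = \<one>" if s: "s \<in> S" for s
    proof (cases "s = \<one>")
      case False
      \<comment> \<open>Transitivity moves a fixed point \<open>z\<close> of \<open>s\<close> to
        \<open>x\<close>, and the corresponding conjugate of \<open>s\<close> is still in
        \<open>S\<close>, where \<open>stab1\<close> applies.\<close>
      have "\<phi> s z \<noteq> z" if z: "z \<in> E" for z
      proof
        assume fix_z: "\<phi> s z = z"
        obtain h where h: "h \<in> carrier G" "\<phi> h z = x" using unique_orbit x z by blast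
        have "\<phi> (conj_by G h s) x = x" using action_conj_by[OF z h(1) SG[OF s]] h fix_z by simp
        moreover have "conj_by G h s \<in> S" using S s h unfolding G.normal_conj_by_iff by blast
        ultimately have "conj_by G h s = \<one>" using stab1 by blast
        then have "conj_by G h s = conj_by G h \<one>" using h by (simp add: conj_by_def)
        then have "s = \<one>" using G.inj_on_conj_by[OF h(1)] SG[OF s] by (simp add: inj_on_eq_iff)
        then show False using False by simp
      qed
      then show ?thesis using der SG[OF s] by blast
    qed simp
    then show ?thesis by blast
  next
    case False
    obtain y where y: "y \<in> carrier G" "\<And>g. g \<in> carrier G \<Longrightarrow> conj_by G g y \<notin> C <#> T"
      using G.ex_not_conjugate_into_proper_subgroup[OF fin CT False] unfolding conj_by_def by blast
    obtain s c where sc: "s \<in> S" "c \<in> C" "y = s \<otimes> c"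
      using y(1) SC[symmetric] unfolding set_mult_def by blast
    have "\<exists>m. d [^] (r ^ m) = \<one>" if d: "d \<in> C" for d
    proof -
      have G: "s \<in> carrier G" "c \<in> carrier G" "d \<in> carrier G" using sc d SG CG by auto
      \<comment> \<open>A fixed point of \<open>s d\<close> puts a conjugate of \<open>s d\<close>
        into \<open>T\<close>. Multiplying by the same conjugate of \<open>c d^-1\<close>, which is
        in \<open>C\<close>, yields a conjugate of \<open>y = s c\<close> in \<open>CT\<close>,
        against the choice of \<open>y\<close>.\<close>
      have "\<phi> (s \<otimes> d) z \<noteq> z" if z: "z \<in> E" for z
      proof
        assume fix_z: "\<phi> (s \<otimes> d) z = z"
        obtain h where h: "h \<in> carrier G" "\<phi> h z = x" using unique_orbit x z by blast
        have "\<phi> (conj_by G h (s \<otimes> d)) x = x"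
          using action_conj_by[OF z h(1), of "s \<otimes> d"] G h fix_z by simp
        then have "conj_by G h (s \<otimes> d) \<in> T" using h G by (simp add: T_def stabilizer_def)
        moreover have "c \<otimes> inv d \<in> C"
          using sc d Csub by (simp add: subgroup.m_closed subgroup.m_inv_closed)
        then have "conj_by G h (c \<otimes> inv d) \<in> C" using C h unfolding G.normal_conj_by_iff by blast
        ultimately have "conj_by G h (c \<otimes> inv d) \<otimes> conj_by G h (s \<otimes> d) \<in> C <#> T"
          by (auto simp: set_mult_def)
        moreover have "y = (c \<otimes> inv d) \<otimes> (s \<otimes> d)"
          using comm[OF sc(1) d] comm[OF sc(1,2)] sc(3) G
          by (simp add: G.m_assoc) (simp flip: G.m_assoc)
        ultimately have "conj_by G h y \<in> C <#> T" using h G by (simp add: G.conj_by_mult)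
        then show False using y h by blast
      qed
      then obtain m where "(s \<otimes> d) [^] (r ^ m) = \<one>" using der[of "s \<otimes> d"] G by auto
      then have "s [^] (r ^ m) \<otimes> d [^] (r ^ m) = \<one>"
        using G.pow_mult_distrib[OF comm[OF sc(1) d]] G by simp
      then have "d [^] (r ^ m) = inv (s [^] (r ^ m))"
        using G G.inv_equality G.inv_inv by (metis G.nat_pow_closed)
      moreover have "s [^] (r ^ m) \<in> S" using G.subgroup_nat_pow_closed[OF Ssub sc(1)] .
      moreover have "d [^] (r ^ m) \<in> C" using G.subgroup_nat_pow_closed[OF Csub d] .
      ultimately have "d [^] (r ^ m) \<in> S \<inter> C"
        using subgroup.m_inv_closed[OF Ssub] by simp
      then show ?thesis unfolding SC1 by blast
    qed
    then show ?thesis by blast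
  qed
qed

subsection \<open>Elementary abelian groups\<close>

text \<open>Addition in \<open>integer_mod_group p\<close> reduces modulo \<open>p\<close>; this
  makes taking powers of \<open>x\<close> a homomorphism on it.\<close>

lemma (in group) int_pow_mod_exponent:
  assumes x: "x \<in> carrier G" and p: "x [^] (p::nat) = \<one>"
  shows "x [^] (z mod int p) = x [^] (z::int)"
proof -
  have "x [^] z = x [^] (int p * (z div int p) + z mod int p)" by simp
  also have "\<dots> = (x [^] int p) [^] (z div int p) \<otimes> x [^] (z mod int p)"
    using x by (simp only: int_pow_mult int_pow_pow)
  also have "\<dots> = x [^] (z mod int p)" using x p by (simp add: int_pow_int)
  finally show ?thesis by simp
qed

context comm_group begin

text \<open>The analogue of adding a vector outside the span to an independent family over the field
  with \<open>p\<close> elements: the new coordinate \<open>k\<close> becomes the exponent of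
  \<open>x\<close>.\<close>

lemma extend_elementary_abelian_embedding:
  fixes p k :: nat
  assumes p: "Factorial_Ring.prime p" and exp: "\<And>x. x \<in> carrier G \<Longrightarrow> x [^] p = \<one>"
    and f: "f \<in> hom (product_group {..<k} (\<lambda>_. integer_mod_group p)) G"
    and inj: "inj_on f (carrier (product_group {..<k} (\<lambda>_. integer_mod_group p)))"
    and x: "x \<in> carrier G" "x \<notin> f ` carrier (product_group {..<k} (\<lambda>_. integer_mod_group p))"
  shows "\<exists>g \<in> hom (product_group {..<Suc k} (\<lambda>_. integer_mod_group p)) G.
    inj_on g (carrier (product_group {..<Suc k} (\<lambda>_. integer_mod_group p)))"
proof -
  define Z where "Z k = product_group {..<k} (\<lambda>_. integer_mod_group p)" for k :: nat
  have carrZ: "carrier (Z k) = (\<Pi>\<^sub>E i\<in>{..<k}. {0..<int p})" for k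
    using p by (simp add: Z_def carrier_integer_mod_group prime_gt_0_nat)
  have multZ: "m \<otimes>\<^bsub>Z k\<^esub> m' = (\<lambda>i\<in>{..<k}. (m i + m' i) mod int p)" for k m m'
    by (simp add: Z_def)
  have oneZ: "\<one>\<^bsub>Z k\<^esub> = (\<lambda>i\<in>{..<k}. 0)" for k by (simp add: Z_def)
  have grpZ: "group (Z k)" for k by (simp add: Z_def)
  interpret F: group_hom "Z k" G f
    using f grpZ is_group by (simp add: group_hom_def group_hom_axioms_def Z_def)
  have H: "subgroup (f ` carrier (Z k)) G" by (rule F.img_is_subgroup)
  define g where "g m = f (restrict m {..<k}) \<otimes> x [^] m k" for m
  have rZ: "restrict m {..<k} \<in> carrier (Z k)" if "m \<in> carrier (Z (Suc k))" for m
    using that by (auto simp: carrZ PiE_iff)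
  have hom: "g \<in> hom (Z (Suc k)) G"
  proof (rule homI)
    show "g m \<in> carrier G" if "m \<in> carrier (Z (Suc k))" for m
      using F.hom_closed[OF rZ[OF that]] x(1) by (simp add: g_def)
    show "g (m \<otimes>\<^bsub>Z (Suc k)\<^esub> m') = g m \<otimes> g m'"
      if m: "m \<in> carrier (Z (Suc k))" "m' \<in> carrier (Z (Suc k))" for m m'
    proof -
      have "restrict (m \<otimes>\<^bsub>Z (Suc k)\<^esub> m') {..<k} = restrict m {..<k} \<otimes>\<^bsub>Z k\<^esub> restrict m' {..<k}"
        by (auto simp: multZ fun_eq_iff)
      then have "f (restrict (m \<otimes>\<^bsub>Z (Suc k)\<^esub> m') {..<k})
          = f (restrict m {..<k}) \<otimes> f (restrict m' {..<k})"
        using F.hom_mult rZ m by metis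
      moreover have "x [^] (m \<otimes>\<^bsub>Z (Suc k)\<^esub> m') k = x [^] m k \<otimes> x [^] m' k"
        using int_pow_mod_exponent[OF x(1) exp[OF x(1)]] x(1) by (simp add: multZ int_pow_mult)
      ultimately show ?thesis
        using F.hom_closed[OF rZ[OF m(1)]] F.hom_closed[OF rZ[OF m(2)]] x(1)
        by (simp add: g_def m_ac)
    qed
  qed
  interpret K: group_hom "Z (Suc k)" G g
    using hom grpZ is_group by (simp add: group_hom_def group_hom_axioms_def)
  have "m = \<one>\<^bsub>Z (Suc k)\<^esub>" if m: "m \<in> carrier (Z (Suc k))" and gm: "g m = \<one>" for m
  proof -
    have fG: "f (restrict m {..<k}) \<in> carrier G" using F.hom_closed[OF rZ[OF m]] .
    have mk: "0 \<le> m k" "m k < int p" using m by (auto simp: carrZ PiE_iff)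
    have "x [^] m k = inv (f (restrict m {..<k}))"
      using gm fG x(1) unfolding g_def by (metis int_pow_closed inv_equality inv_inv)
    then have xH: "x [^] m k \<in> f ` carrier (Z k)"
      using subgroup.m_inv_closed[OF H] rZ[OF m] by simp
    \<comment> \<open>A nonzero coordinate is invertible modulo \<open>p\<close>. By Bezout,
      \<open>x\<close> would then be a power of \<open>x [^] m k\<close>, since
      \<open>x [^] p = \<one>\<close>, and so lie in the image of \<open>f\<close>.\<close>
    have m0: "m k = 0"
    proof (rule ccontr)
      assume "m k \<noteq> 0"
      then have "\<not> int p dvd m k" using mk zdvd_not_zless by force
      then have "coprime (m k) (int p)"
        using p by (simp add: prime_imp_coprime coprime_commute)
      then obtain u v where "u * m k + v * int p = 1"
        using bezout_int[of "m k" "int p"] by auto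
      then have "x = x [^] (m k * u + int p * v)" using x(1) by (simp add: mult.commute)
      also have "\<dots> = (x [^] m k) [^] u \<otimes> (x [^] int p) [^] v"
        using x(1) by (simp only: int_pow_mult int_pow_pow)
      also have "\<dots> = (x [^] m k) [^] u" using x(1) exp by (simp add: int_pow_int)
      also have "\<dots> \<in> f ` carrier (Z k)" using subgroup_int_pow_closed[OF H xH] .
      finally show False using x(2) by (simp add: Z_def)
    qed
    then have "f (restrict m {..<k}) = \<one>" using gm fG by (simp add: g_def)
    then have "restrict m {..<k} = \<one>\<^bsub>Z k\<^esub>"
      using inj rZ[OF m] F.hom_one unfolding Z_def[symmetric]
      by (metis F.G.one_closed inj_onD)
    then have "m i = 0" if "i < k" for i
      using that by (metis lessThan_iff oneZ restrict_apply')
    then have "m i = 0" if "i < Suc k" for i using that m0 by (auto simp: less_Suc_eq)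
    \<comment> \<open>The coordinates agree only on \<open>{..<Suc k}\<close>; equality as functions
      comes from extensionality of the members of the product.\<close>
    then show ?thesis using m unfolding oneZ carrZ
      by (intro extensionalityI[of m "{..<Suc k}"]) (auto simp: PiE_iff)
  qed
  then have "inj_on g (carrier (Z (Suc k)))" using K.inj_on_one_iff by blast
  then show ?thesis using hom unfolding Z_def by blast
qed

text \<open>Take the largest \<open>k\<close> for which the \<open>k\<close>-fold product embeds. It
  exists because \<open>k < p ^ k\<close> and \<open>p ^ k\<close> is at most the order of
  \<open>G\<close>, and the embedding is onto because otherwise it could be extended.\<close>

lemma elementary_abelian_iso_product_group:
  assumes fin: "finite (carrier G)" and nontriv: "carrier G \<noteq> {\<one>}"
    and p: "Factorial_Ring.prime p" and exp: "\<And>x. x \<in> carrier G \<Longrightarrow> x [^] (p::nat) = \<one>"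
  shows "\<exists>k::nat. k \<ge> 1 \<and> G \<cong> product_group {..<k} (\<lambda>_. integer_mod_group p)"
proof -
  let ?Z = "\<lambda>k::nat. product_group {..<k} (\<lambda>_. integer_mod_group p)"
  define Q where "Q k \<longleftrightarrow> (\<exists>f\<in>hom (?Z k) G. inj_on f (carrier (?Z k)))" for k
  \<comment> \<open>Over the empty index set the product has one element, so even the constant map
    is injective.\<close>
  have Q0: "Q 0" unfolding Q_def by (intro bexI[of _ "\<lambda>_. \<one>"]) (auto simp: hom_def)
  have bound: "k \<le> order G" if "Q k" for k
  proof -
    obtain f where "f \<in> hom (?Z k) G" "inj_on f (carrier (?Z k))"
      using \<open>Q k\<close> unfolding Q_def by blast
    then have "card (carrier (?Z k)) \<le> order G"
      using fin by (auto simp: order_def hom_def intro!: card_inj_on_le[of f])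
    moreover have "card (carrier (?Z k)) = p ^ k"
      using p by (simp add: carrier_integer_mod_group card_PiE prime_gt_0_nat)
    moreover have "k < p ^ k" using power_gt_expt[of p k] prime_gt_1_nat[OF p] by simp
    ultimately show ?thesis by simp
  qed
  define k where "k = Greatest Q"
  have "Q k" unfolding k_def using GreatestI_nat[of Q, OF Q0] bound by blast
  have "\<not> Q (Suc k)" using Greatest_le_nat[of Q "Suc k" "order G"] bound by (auto simp: k_def)
  obtain f where f: "f \<in> hom (?Z k) G" "inj_on f (carrier (?Z k))"
    using \<open>Q k\<close> unfolding Q_def by blast
  have "f ` carrier (?Z k) = carrier G"
  proof
    show "f ` carrier (?Z k) \<subseteq> carrier G" using f(1) by (auto simp: hom_def)
    show "carrier G \<subseteq> f ` carrier (?Z k)"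
      using extend_elementary_abelian_embedding[OF p exp f] \<open>\<not> Q (Suc k)\<close> unfolding Q_def by blast
  qed
  then have iso: "f \<in> iso (?Z k) G" using f by (simp add: iso_def bij_betw_def)
  have "k \<noteq> 0"
  proof
    assume "k = 0"
    then have "card (carrier G) = 1"
      using bij_betw_same_card[of f "carrier (?Z k)" "carrier G"] iso by (simp add: iso_def)
    then show False using nontriv by (metis card_1_singletonE one_closed singletonD)
  qed
  moreover have "G \<cong> ?Z k"
    using iso group.iso_sym[of "?Z k" G] by (auto simp: is_iso_def)
  ultimately show ?thesis by (intro exI[of _ k]) simp
qed

end

subsection \<open>Almost simple groups\<close>

text \<open>The kernel of the conjugation action of \<open>G\<close> on \<open>N\<close> is the
  centralizer of \<open>N\<close>, so \<open>G\<close> embeds into the automorphism group of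
  \<open>N\<close>, and the elements of \<open>N\<close> itself induce the inner automorphisms.
  \<open>N\<close> with the operations of \<open>G\<close> is the witness for the simple group,
  which is why \<open>G\<close> is a plain \<open>'a monoid\<close>.\<close>

lemma almost_simple_if_centralizer_trivial:
  fixes G :: "'a monoid" (structure)
  assumes "group G" and fin: "finite (carrier G)" and N: "N \<lhd> G"
    and simple: "simple_group (G\<lparr>carrier := N\<rparr>)" and ncomm: "\<not> comm_group (G\<lparr>carrier := N\<rparr>)"
    and cent: "centralizer G N = {\<one>}"
  shows "almost_simple G"
proof -
  interpret group G by fact
  have Nsub: "subgroup N G" using N normal_imp_subgroup by blast
  have NG: "\<And>x. x \<in> N \<Longrightarrow> x \<in> carrier G" using Nsub subgroup.subset by blast
  have Nconj: "conj_by G g x \<in> N" if "g \<in> carrier G" "x \<in> N" for g x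
    using N that unfolding normal_conj_by_iff by blast
  define S where "S = G\<lparr>carrier := N\<rparr>"
  interpret S: group S unfolding S_def by (rule subgroup_imp_group[OF Nsub])
  \<comment> \<open>The restriction is essential: \<open>Bij N\<close> contains only functions that
    are extensional on \<open>N\<close>.\<close>
  define \<theta> where "\<theta> g = (\<lambda>x\<in>N. conj_by G g x)" for g
  have \<theta>_Bij: "\<theta> g \<in> Bij N" if g: "g \<in> carrier G" for g
  proof -
    have "bij_betw (\<theta> g) N N"
    proof (rule bij_betwI[where g = "conj_by G (inv g)"])
      show "\<theta> g \<in> N \<rightarrow> N" "conj_by G (inv g) \<in> N \<rightarrow> N" using Nconj g by (auto simp: \<theta>_def)
      show "conj_by G (inv g) (\<theta> g x) = x" if "x \<in> N" for x using that g NG by (simp add: \<theta>_def)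
      show "\<theta> g (conj_by G (inv g) x) = x" if "x \<in> N" for x
        using that g NG Nconj[of "inv g" x] by (simp add: \<theta>_def)
    qed
    then show ?thesis by (simp add: Bij_def \<theta>_def)
  qed
  have \<theta>_auto: "\<theta> g \<in> auto S" if g: "g \<in> carrier G" for g
  proof -
    have "\<theta> g \<in> hom S S"
      using g Nconj NG subgroup.m_closed[OF Nsub]
      by (auto simp: hom_def S_def \<theta>_def conj_by_mult)
    then show ?thesis using \<theta>_Bij[OF g] by (simp add: auto_def S_def)
  qed
  have \<theta>_mult: "\<theta> (g \<otimes> h) = \<theta> g \<otimes>\<^bsub>AutoGroup S\<^esub> \<theta> h"
    if gh: "g \<in> carrier G" "h \<in> carrier G" for g h
  proof -
    have "\<theta> g \<otimes>\<^bsub>AutoGroup S\<^esub> \<theta> h = compose N (\<theta> g) (\<theta> h)"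
      using \<theta>_Bij gh by (simp add: AutoGroup_def BijGroup_def S_def)
    also have "\<dots> = \<theta> (g \<otimes> h)"
      using gh NG Nconj by (auto simp: compose_def \<theta>_def fun_eq_iff conj_by_comp)
    finally show ?thesis by simp
  qed
  have "\<theta> \<in> hom G (AutoGroup S)" using \<theta>_auto \<theta>_mult by (auto simp: hom_def AutoGroup_def)
  then interpret \<theta>: group_hom G "AutoGroup S" \<theta>
    using S.AutoGroup is_group by (simp add: group_hom_def group_hom_axioms_def)
  have "g = \<one>" if g: "g \<in> carrier G" "\<theta> g = \<one>\<^bsub>AutoGroup S\<^esub>" for g
  proof -
    have "\<theta> g = (\<lambda>x\<in>N. x)" using g by (simp add: AutoGroup_def BijGroup_def S_def)
    then have "conj_by G g x = x" if "x \<in> N" for x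
      using that unfolding \<theta>_def by (metis restrict_apply')
    then have "g \<in> centralizer G N"
      using g NG by (auto simp: centralizer_def conj_by_eq_iff_commute)
    then show ?thesis using cent by blast
  qed
  then have inj: "inj_on \<theta> (carrier G)" using \<theta>.inj_on_one_iff by blast
  define K where "K = \<theta> ` carrier G"
  have "\<theta> \<in> iso G (AutoGroup S\<lparr>carrier := K\<rparr>)"
    using inj \<theta>.hom_mult by (auto simp: iso_def hom_def bij_betw_def K_def)
  then have "G \<cong> AutoGroup S\<lparr>carrier := K\<rparr>" by (auto simp: is_iso_def)
  moreover have "subgroup K (AutoGroup S)" unfolding K_def by (rule \<theta>.img_is_subgroup)
  moreover have "inner_auts S \<subseteq> K"
  proof
    fix \<phi> assume "\<phi> \<in> inner_auts S"
    then obtain s where s: "s \<in> N" "\<phi> = (\<lambda>x\<in>N. s \<otimes> x \<otimes> inv\<^bsub>S\<^esub> s)"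
      unfolding inner_auts_def S_def by auto
    have "inv\<^bsub>S\<^esub> s = inv s" unfolding S_def using m_inv_consistent[OF Nsub s(1)] .
    then have "\<phi> = \<theta> s" using s by (simp add: \<theta>_def conj_by_def)
    then show "\<phi> \<in> K" using s NG by (simp add: K_def)
  qed
  moreover have "finite (carrier S)" using fin Nsub NG by (auto simp: S_def intro: finite_subset)
  ultimately show ?thesis
    unfolding almost_simple_def using simple ncomm unfolding S_def[symmetric] by blast
qed

subsection \<open>Primitive groups\<close>

locale primitive_group =
  fixes \<Omega> :: "'a set" and G :: "('a \<Rightarrow> 'a) set"
  assumes fin_\<Omega>: "finite \<Omega>" and card_\<Omega>: "card \<Omega> \<ge> 2" and prim: "primitive_perm_group \<Omega> G"
begin

abbreviation \<G> where "\<G> \<equiv> perm_group \<Omega> G"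

sublocale transitive_action \<G> \<Omega> "\<lambda>g. g"
  using prim by (simp add: primitive_perm_group_def transitive_on_def)

sublocale group \<G>
  using group_hom group_hom.axioms(1) by blast

lemma finite_G: "finite (carrier \<G>)"
proof -
  have "carrier \<G> \<subseteq> \<Omega> \<rightarrow>\<^sub>E \<Omega>"
  proof
    fix g assume "g \<in> carrier \<G>"
    then have "g \<in> Bij \<Omega>" by (rule bij_prop0)
    then show "g \<in> \<Omega> \<rightarrow>\<^sub>E \<Omega>" using Bij_imp_funcset[of g] Bij_imp_extensional[of g] unfolding PiE_def by blast
  qed
  then show ?thesis using fin_\<Omega> finite_PiE finite_subset by metis
qed

lemma \<Omega>_nonempty: "\<Omega> \<noteq> {}"
  using card_\<Omega> by auto

lemma faithful:
  assumes "g \<in> carrier \<G>" "\<And>x. x \<in> \<Omega> \<Longrightarrow> g x = x"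
  shows "g = \<one>\<^bsub>\<G>\<^esub>"
proof -
  have "g \<in> extensional \<Omega>" using bij_prop0[OF assms(1)] by (rule Bij_imp_extensional)
  then have "g = (\<lambda>x\<in>\<Omega>. x)" using assms(2) by (intro extensionalityI[of g \<Omega>]) auto
  then show ?thesis by (simp add: BijGroup_def)
qed

lemma nontrivial: "carrier \<G> \<noteq> {\<one>\<^bsub>\<G>\<^esub>}"
proof
  assume triv: "carrier \<G> = {\<one>\<^bsub>\<G>\<^esub>}"
  have "\<not> card \<Omega> \<le> Suc 0" using card_\<Omega> by simp
  then obtain x y where xy: "x \<in> \<Omega>" "y \<in> \<Omega>" "x \<noteq> y"
    using card_le_Suc0_iff_eq[OF fin_\<Omega>] by blast
  then obtain g where "g \<in> carrier \<G>" "g x = y" using unique_orbit by blast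
  then have "\<one>\<^bsub>\<G>\<^esub> x = y" unfolding triv by blast
  then show False using xy by (simp add: BijGroup_def)
qed

lemma subgroup_action: "subgroup N \<G> \<Longrightarrow> group_action (perm_group \<Omega> N) \<Omega> (\<lambda>g. g)"
  using induced_action[of N] by simp

text \<open>Since \<open>g (n x) = (g n g^-1) (g x)\<close>, the group \<open>G\<close> permutes the
  \<open>N\<close>-orbits, and primitivity leaves a single orbit or only singletons. In the latter
  case \<open>N\<close> fixes every point and is trivial by faithfulness.\<close>

lemma transitive_on_if_normal:
  assumes N: "N \<lhd> \<G>" "N \<noteq> {\<one>\<^bsub>\<G>\<^esub>}"
  shows "transitive_on \<Omega> N"
proof -
  have Nsub: "subgroup N \<G>" using N normal_imp_subgroup by blast
  have NG: "\<And>n. n \<in> N \<Longrightarrow> n \<in> carrier \<G>" using subgroup.subset[OF Nsub] by blast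
  interpret A: group_action "perm_group \<Omega> N" \<Omega> "\<lambda>g. g" using Nsub by (rule subgroup_action)
  let ?orb = "orbit (perm_group \<Omega> N) (\<lambda>g. g)" and ?P = "orbits (perm_group \<Omega> N) \<Omega> (\<lambda>g. g)"
  have orb: "?orb x = {n x | n. n \<in> N}" for x by (simp add: orbit_def)
  have "partition_on \<Omega> ?P"
  proof (rule partition_onI)
    show "\<Union> ?P = \<Omega>" by (rule A.orbits_coverture)
    show "disjnt p q" if "p \<in> ?P" "q \<in> ?P" "p \<noteq> q" for p q
      using A.disjoint_union that by (auto simp: disjnt_def)
    show "{} \<notin> ?P" using A.orbit_refl by (auto simp: orbits_def)
  qed
  moreover have "g ` B \<in> ?P" if g: "g \<in> G" and B: "B \<in> ?P" for g B
  proof -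
    obtain x where x: "x \<in> \<Omega>" "B = ?orb x" using B by (auto simp: orbits_def)
    have gG: "g \<in> carrier \<G>" using g by simp
    have gx: "g x \<in> \<Omega>" using element_image[OF gG x(1)] by simp
    have "g ` ?orb x = ?orb (g x)"
    proof
      show "g ` ?orb x \<subseteq> ?orb (g x)"
      proof
        fix y assume "y \<in> g ` ?orb x"
        then obtain n where n: "n \<in> N" "y = g (n x)" unfolding orb by blast
        have "y = conj_by \<G> g n (g x)" using action_conj_by[OF x(1) gG NG[OF n(1)]] n by simp
        moreover have "conj_by \<G> g n \<in> N" using N(1) n gG unfolding normal_conj_by_iff by blast
        ultimately show "y \<in> ?orb (g x)" unfolding orb by blast
      qed
      show "?orb (g x) \<subseteq> g ` ?orb x"
      proof
        fix y assume "y \<in> ?orb (g x)"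
        then obtain n where n: "n \<in> N" "y = n (g x)" unfolding orb by blast
        have m: "conj_by \<G> (inv\<^bsub>\<G>\<^esub> g) n \<in> N"
          using N(1) n gG inv_closed[OF gG] unfolding normal_conj_by_iff by blast
        have "y = g (conj_by \<G> (inv\<^bsub>\<G>\<^esub> g) n x)"
          using action_conj_by[OF x(1) gG NG[OF m]] conj_by_inv_cancel(1)[OF gG NG[OF n(1)]] n(2)
          by simp
        then show "y \<in> g ` ?orb x" unfolding orb using m by blast
      qed
    qed
    then show ?thesis using x gx by (auto simp: orbits_def)
  qed
  ultimately consider "?P = {\<Omega>}" | "?P = (\<lambda>x. {x}) ` \<Omega>"
    using prim unfolding primitive_perm_group_def by blast
  then show ?thesis
  proof cases
    case 1
    have "\<exists>n\<in>N. n x = y" if "x \<in> \<Omega>" "y \<in> \<Omega>" for x y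
    proof -
      have "?orb x \<in> ?P" using that by (auto simp: orbits_def)
      then have "y \<in> ?orb x" using 1 that by blast
      then show ?thesis unfolding orb by blast
    qed
    then show ?thesis
      unfolding transitive_on_def by unfold_locales simp
  next
    case 2
    have "n = \<one>\<^bsub>\<G>\<^esub>" if n: "n \<in> N" for n
    proof (rule faithful[OF NG[OF n]])
      fix x assume x: "x \<in> \<Omega>"
      have "?orb x \<in> ?P" using x by (auto simp: orbits_def)
      then obtain z where "?orb x = {z}" using 2 by blast
      moreover have "x \<in> ?orb x" using A.orbit_refl x by blast
      moreover have "n x \<in> ?orb x" unfolding orb using n by blast
      ultimately show "n x = x" by simp
    qed
    then show ?thesis using N(2) subgroup.one_closed[OF Nsub] by blast
  qed
qed

lemma transitive_onD: "\<lbrakk>transitive_on \<Omega> N; x \<in> \<Omega>; y \<in> \<Omega>\<rbrakk> \<Longrightarrow> \<exists>n\<in>N. n x = y"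
  using transitive_action.unique_orbit[of "perm_group \<Omega> N" \<Omega> "\<lambda>g. g" x y]
  by (simp add: transitive_on_def)

text \<open>\<open>c (n x) = n (c x) = n x\<close>, and the points \<open>n x\<close> exhaust
  \<Omega>.\<close>

lemma centralizer_semiregular:
  assumes N: "transitive_on \<Omega> N" "N \<subseteq> carrier \<G>"
    and c: "c \<in> centralizer \<G> N" and x: "x \<in> \<Omega>" "c x = x"
  shows "c = \<one>\<^bsub>\<G>\<^esub>"
proof (rule faithful)
  show cG: "c \<in> carrier \<G>" using c centralizer_subset by blast
  fix y assume "y \<in> \<Omega>"
  then obtain n where n: "n \<in> N" "n x = y" using transitive_onD[OF N(1) x(1)] by blast
  have nG: "n \<in> carrier \<G>" using n N by blast
  have "c \<otimes>\<^bsub>\<G>\<^esub> n = n \<otimes>\<^bsub>\<G>\<^esub> c" using c n(1) unfolding centralizer_def by blast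
  then have "c (n x) = n (c x)"
    using composition_rule[OF x(1) cG nG] composition_rule[OF x(1) nG cG] by simp
  then show "c y = y" using n x by simp
qed

text \<open>Everything follows from \<open>N\<close> being its own centralizer. Its elements are
  then semiregular, and another minimal normal subgroup, which would meet \<open>N\<close> trivially
  and hence commute with it, would already be contained in \<open>N\<close>.\<close>

lemma affine_if_minimal_normal_comm:
  assumes min: "minimal_normal N \<G>" and comm: "comm_group (\<G>\<lparr>carrier := N\<rparr>)"
  shows "affine_perm_group \<Omega> G"
proof -
  have N: "N \<lhd> \<G>" "N \<noteq> {\<one>\<^bsub>\<G>\<^esub>}" using min by (auto simp: minimal_normal_def)
  have Nsub: "subgroup N \<G>" using N normal_imp_subgroup by blast
  have NG: "N \<subseteq> carrier \<G>" using subgroup.subset[OF Nsub] .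
  have trans: "transitive_on \<Omega> N" using transitive_on_if_normal N by blast
  have Ncent: "N \<subseteq> centralizer \<G> N"
  proof
    fix x assume x: "x \<in> N"
    have "x \<otimes>\<^bsub>\<G>\<^esub> y = y \<otimes>\<^bsub>\<G>\<^esub> x" if "y \<in> N" for y
      using comm_monoid.m_comm[OF comm_group.axioms(1)[OF comm], of x y] x that by simp
    then show "x \<in> centralizer \<G> N" using x NG unfolding centralizer_def by blast
  qed
  have self_cent: "c \<in> N" if c: "c \<in> centralizer \<G> N" for c
  proof -
    obtain x where x: "x \<in> \<Omega>" using \<Omega>_nonempty by blast
    have cG: "c \<in> carrier \<G>" using c centralizer_subset by blast
    have cx: "c x \<in> \<Omega>" using element_image[OF cG x] by simp
    \<comment> \<open>\<open>N\<close> is transitive, so some \<open>n\<close> agrees with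
      \<open>c\<close> at \<open>x\<close>. As \<open>N\<close> is abelian, \<open>n^-1 c\<close>
      again centralizes \<open>N\<close>; it fixes \<open>x\<close>, so semiregularity gives
      \<open>c = n\<close>.\<close>
    obtain n where n: "n \<in> N" "n x = c x" using transitive_onD[OF trans x cx] by blast
    have nG: "n \<in> carrier \<G>" using n NG by blast
    have Z: "subgroup (centralizer \<G> N) \<G>" using subgroup_centralizer[OF NG] .
    have "inv\<^bsub>\<G>\<^esub> n \<otimes>\<^bsub>\<G>\<^esub> c \<in> centralizer \<G> N"
      using subgroup.m_closed[OF Z subgroup.m_inv_closed[OF Z] c] n Ncent by blast
    moreover have "(inv\<^bsub>\<G>\<^esub> n \<otimes>\<^bsub>\<G>\<^esub> c) x = x"
      using composition_rule[OF x inv_closed[OF nG] cG] orbit_sym_aux[OF nG x n(2)] by simp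
    ultimately have "inv\<^bsub>\<G>\<^esub> n \<otimes>\<^bsub>\<G>\<^esub> c = \<one>\<^bsub>\<G>\<^esub>"
      using centralizer_semiregular[OF trans NG _ x] by blast
    then have "c = n" using inv_mult_cancel_left(2)[OF nG cG] r_one[OF nG] by simp
    then show ?thesis using n by simp
  qed
  have "M = N" if M: "minimal_normal M \<G>" for M
  proof -
    have Mn: "M \<lhd> \<G>" "M \<noteq> {\<one>\<^bsub>\<G>\<^esub>}"
      and Mmin: "\<And>L. \<lbrakk>L \<lhd> \<G>; L \<subseteq> M\<rbrakk> \<Longrightarrow> L = {\<one>\<^bsub>\<G>\<^esub>} \<or> L = M"
      using M by (auto simp: minimal_normal_def)
    have Msub: "subgroup M \<G>" using Mn normal_imp_subgroup by blast
    have MG: "M \<subseteq> carrier \<G>" using subgroup.subset[OF Msub] .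
    have "M \<inter> N \<noteq> {\<one>\<^bsub>\<G>\<^esub>}"
    proof
      assume MN: "M \<inter> N = {\<one>\<^bsub>\<G>\<^esub>}"
      have "m \<otimes>\<^bsub>\<G>\<^esub> n = n \<otimes>\<^bsub>\<G>\<^esub> m" if "m \<in> M" "n \<in> N" for m n
        using commute_if_normalize_inter_trivial[OF Msub Nsub MN _ _ that] Mn(1) N(1) MG NG
        unfolding normal_conj_by_iff by blast
      then have "M \<subseteq> centralizer \<G> N" using MG unfolding centralizer_def by blast
      then show False using self_cent MN Mn(2) by blast
    qed
    then have "M \<inter> N = M" using Mmin[OF normal_subgroup_intersect[OF Mn(1) N(1)]] by blast
    then show "M = N" using min Mn unfolding minimal_normal_def by blast
  qed
  then have "{M. minimal_normal M \<G>} = {N}" using min by blast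
  then have socle: "socle \<G> = N"
    using generateI[OF Nsub, of N] unfolding socle_def by simp
  obtain p :: nat where p: "Factorial_Ring.prime p" "\<And>x. x \<in> N \<Longrightarrow> x [^]\<^bsub>\<G>\<^esub> p = \<one>\<^bsub>\<G>\<^esub>"
    using minimal_normal_comm_exponent_prime[OF finite_G min comm] by blast
  have iso: "\<exists>k::nat. k \<ge> 1 \<and> \<G>\<lparr>carrier := N\<rparr> \<cong> product_group {..<k} (\<lambda>_. integer_mod_group p)"
  proof (rule comm_group.elementary_abelian_iso_product_group[OF comm _ _ p(1)])
    show "finite (carrier (\<G>\<lparr>carrier := N\<rparr>))" using finite_subset[OF NG finite_G] by simp
    show "carrier (\<G>\<lparr>carrier := N\<rparr>) \<noteq> {\<one>\<^bsub>\<G>\<lparr>carrier := N\<rparr>\<^esub>}" using N(2) by simp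
    show "x [^]\<^bsub>\<G>\<lparr>carrier := N\<rparr>\<^esub> p = \<one>\<^bsub>\<G>\<lparr>carrier := N\<rparr>\<^esub>"
      if "x \<in> carrier (\<G>\<lparr>carrier := N\<rparr>)" for x
      using p(2)[of x] that nat_pow_consistent[of x p N] by simp
  qed
  have "stabilizer (perm_group \<Omega> N) (\<lambda>g. g) x = {\<one>\<^bsub>BijGroup \<Omega>\<^esub>}" if x: "x \<in> \<Omega>" for x
  proof -
    have "n = \<one>\<^bsub>\<G>\<^esub>" if "n \<in> N" "n x = x" for n
      using centralizer_semiregular[OF trans NG _ x] that Ncent by blast
    moreover have "\<one>\<^bsub>\<G>\<^esub> x = x" using x by (simp add: BijGroup_def)
    ultimately have "{n \<in> N. n x = x} = {\<one>\<^bsub>\<G>\<^esub>}"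
      using subgroup.one_closed[OF Nsub] by blast
    then show ?thesis by (simp add: stabilizer_def)
  qed
  then have "regular_on \<Omega> N" using trans unfolding regular_on_def by blast
  moreover obtain k :: nat where
    "k \<ge> 1" "perm_group \<Omega> N \<cong> product_group {..<k} (\<lambda>_. integer_mod_group p)"
    using iso by auto
  ultimately show ?thesis unfolding affine_perm_group_def Let_def socle using p(1) by blast
qed

lemma almost_simple_if_minimal_normal_not_comm:
  fixes r :: nat
  assumes r: "Factorial_Ring.prime r"
    and der: "\<And>g. \<lbrakk>g \<in> carrier \<G>; \<forall>x\<in>\<Omega>. g x \<noteq> x\<rbrakk> \<Longrightarrow> \<exists>m. g [^]\<^bsub>\<G>\<^esub> (r ^ m) = \<one>\<^bsub>\<G>\<^esub>"
    and min: "minimal_normal N \<G>" and ncomm: "\<not> comm_group (\<G>\<lparr>carrier := N\<rparr>)"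
  shows "almost_simple \<G>"
proof -
  have N: "N \<lhd> \<G>" "N \<noteq> {\<one>\<^bsub>\<G>\<^esub>}" using min by (auto simp: minimal_normal_def)
  have Nsub: "subgroup N \<G>" using N normal_imp_subgroup by blast
  have NG: "N \<subseteq> carrier \<G>" using subgroup.subset[OF Nsub] .
  have trans: "transitive_on \<Omega> N" using transitive_on_if_normal N by blast
  have cent: "centralizer \<G> N = {\<one>\<^bsub>\<G>\<^esub>}"
  proof (rule ccontr)
    assume Z: "centralizer \<G> N \<noteq> {\<one>\<^bsub>\<G>\<^esub>}"
    have Ztrans: "transitive_on \<Omega> (centralizer \<G> N)"
      using transitive_on_if_normal[OF normal_centralizer[OF N(1)] Z] .
    have "\<exists>m. n [^]\<^bsub>\<G>\<^esub> (r ^ m) = \<one>\<^bsub>\<G>\<^esub>" if n: "n \<in> N" for n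
    proof (cases "n = \<one>\<^bsub>\<G>\<^esub>")
      case False
      have nG: "n \<in> carrier \<G>" using n NG by blast
      \<comment> \<open>The roles are exchanged: \<open>N\<close> centralizes its own centralizer,
        and the transitivity of the latter makes \<open>N\<close> semiregular.\<close>
      have "n \<in> centralizer \<G> (centralizer \<G> N)"
        using n nG unfolding centralizer_def by auto
      then have "\<forall>x\<in>\<Omega>. n x \<noteq> x"
        using centralizer_semiregular[OF Ztrans centralizer_subset] False by blast
      then show ?thesis using der nG by blast
    qed (simp only: nat_pow_one simp_thms)
    then show False
      using minimal_normal_comm_if_elements_prime_pow[OF finite_G r min] ncomm by blast
  qed
  have "simple_group (\<G>\<lparr>carrier := N\<rparr>)"
  proof (rule ccontr)
    assume "\<not> simple_group (\<G>\<lparr>carrier := N\<rparr>)"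
    then obtain S C g where S: "S \<lhd> \<G>\<lparr>carrier := N\<rparr>" "S \<noteq> {\<one>\<^bsub>\<G>\<^esub>}"
      and C: "C \<lhd> \<G>\<lparr>carrier := N\<rparr>" and SC1: "S \<inter> C = {\<one>\<^bsub>\<G>\<^esub>}"
      and comm: "\<And>s c. \<lbrakk>s \<in> S; c \<in> C\<rbrakk> \<Longrightarrow> s \<otimes>\<^bsub>\<G>\<^esub> c = c \<otimes>\<^bsub>\<G>\<^esub> s"
      and SC: "S <#>\<^bsub>\<G>\<^esub> C = N" and g: "g \<in> carrier \<G>" "conj_by \<G> g ` S \<subseteq> C"
      using minimal_normal_decomposition[OF finite_G min ncomm] by blast
    have Ssub: "subgroup S \<G>" and SN: "S \<subseteq> N" and Csub: "subgroup C \<G>"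
      using S(1) C unfolding normal_in_subgroup_iff[OF Nsub] by auto
    have SG: "S \<subseteq> carrier \<G>" and CG: "C \<subseteq> carrier \<G>"
      using subgroup.subset[OF Ssub] subgroup.subset[OF Csub] .
    have pow: "x [^]\<^bsub>\<G>\<lparr>carrier := N\<rparr>\<^esub> n = x [^]\<^bsub>\<G>\<^esub> n" for x and n :: nat
      by (rule nat_pow_consistent[symmetric])
    interpret A: transitive_action "\<G>\<lparr>carrier := N\<rparr>" \<Omega> "\<lambda>g. g"
      using trans by (simp add: transitive_on_def)
    have "(\<forall>s\<in>S. \<exists>m. s [^]\<^bsub>\<G>\<lparr>carrier := N\<rparr>\<^esub> (r ^ m) = \<one>\<^bsub>\<G>\<lparr>carrier := N\<rparr>\<^esub>) \<or>
        (\<forall>c\<in>C. \<exists>m. c [^]\<^bsub>\<G>\<lparr>carrier := N\<rparr>\<^esub> (r ^ m) = \<one>\<^bsub>\<G>\<lparr>carrier := N\<rparr>\<^esub>)"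
    proof (rule A.factor_elements_prime_pow[OF _ \<Omega>_nonempty _ _ S(1) C])
      show "finite (carrier (\<G>\<lparr>carrier := N\<rparr>))" using finite_subset[OF NG finite_G] by simp
      show "g = \<one>\<^bsub>\<G>\<lparr>carrier := N\<rparr>\<^esub>" if "g \<in> carrier (\<G>\<lparr>carrier := N\<rparr>)" "\<forall>x\<in>\<Omega>. g x = x" for g
        using faithful[of g] that NG by auto
      show "\<exists>m. g [^]\<^bsub>\<G>\<lparr>carrier := N\<rparr>\<^esub> (r ^ m) = \<one>\<^bsub>\<G>\<lparr>carrier := N\<rparr>\<^esub>"
        if "g \<in> carrier (\<G>\<lparr>carrier := N\<rparr>)" "\<forall>x\<in>\<Omega>. g x \<noteq> x" for g
        using der[of g] that NG unfolding pow by auto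
    qed (use SC1 SC comm in \<open>simp_all add: set_mult_def\<close>)
    then have "(\<forall>s\<in>S. \<exists>m. s [^]\<^bsub>\<G>\<^esub> (r ^ m) = \<one>\<^bsub>\<G>\<^esub>) \<or> (\<forall>c\<in>C. \<exists>m. c [^]\<^bsub>\<G>\<^esub> (r ^ m) = \<one>\<^bsub>\<G>\<^esub>)"
      unfolding pow by simp
    \<comment> \<open>If \<open>C\<close> is the factor consisting of r-elements, the property
      passes to \<open>S\<close> through its conjugate inside \<open>C\<close>, because conjugation
      by \<open>g\<close> is an injective homomorphism.\<close>
    moreover have "\<exists>m. s [^]\<^bsub>\<G>\<^esub> (r ^ m) = \<one>\<^bsub>\<G>\<^esub>"
      if Cpow: "\<forall>c\<in>C. \<exists>m. c [^]\<^bsub>\<G>\<^esub> (r ^ m) = \<one>\<^bsub>\<G>\<^esub>" and s: "s \<in> S" for s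
    proof -
      have sG: "s \<in> carrier \<G>" using s SG by blast
      obtain m where "conj_by \<G> g s [^]\<^bsub>\<G>\<^esub> (r ^ m) = \<one>\<^bsub>\<G>\<^esub>" using Cpow g(2) s by blast
      then have "conj_by \<G> g (s [^]\<^bsub>\<G>\<^esub> (r ^ m)) = conj_by \<G> g \<one>\<^bsub>\<G>\<^esub>"
        using conj_by_pow[OF g(1) sG] group_hom.hom_one[OF conj_by_hom[OF g(1)]] by simp
      then show ?thesis
        using inj_onD[OF inj_on_conj_by[OF g(1)]] nat_pow_closed[OF sG] one_closed by blast
    qed
    ultimately have "\<And>s. s \<in> S \<Longrightarrow> \<exists>m. s [^]\<^bsub>\<G>\<^esub> (r ^ m) = \<one>\<^bsub>\<G>\<^esub>" by blast
    then obtain z where z: "z \<in> S" "z \<noteq> \<one>\<^bsub>\<G>\<^esub>" "z \<in> centralizer \<G> S"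
      using ex_center_if_elements_prime_pow[OF finite_G r Ssub S(2)] by blast
    moreover have "z \<in> centralizer \<G> C"
      using comm[OF z(1)] z(1) SG unfolding centralizer_def by blast
    ultimately have "z \<in> centralizer \<G> N" using mem_centralizer_set_mult[OF SG CG] SC by blast
    then show False using cent z(2) by blast
  qed
  then show ?thesis
    using almost_simple_if_centralizer_trivial[OF is_group finite_G N(1) _ ncomm cent] by blast
qed

end

theorem theorem1:
  fixes \<Omega> :: "'a set" and G :: "('a \<Rightarrow> 'a) set" and r :: nat
  assumes "finite \<Omega>" and "card \<Omega> \<ge> 2"
    and "primitive_perm_group \<Omega> G"
    and "Factorial_Ring.prime r"
    and "\<forall>g\<in>G. derangement \<Omega> g \<longrightarrow> r_element (perm_group \<Omega> G) r g"
  shows "almost_simple (perm_group \<Omega> G) \<or> affine_perm_group \<Omega> G"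
proof -
  interpret primitive_group \<Omega> G using assms(1-3) by unfold_locales
  obtain N where N: "minimal_normal N \<G>"
    using ex_minimal_normal[OF finite_G nontrivial] by blast
  \<comment> \<open>Orders are traded for the equation \<open>g^(r^m) = 1\<close>, which passes
    directly to subgroups, conjugates and commuting factors.\<close>
  have der: "\<exists>m. g [^]\<^bsub>\<G>\<^esub> (r ^ m) = \<one>\<^bsub>\<G>\<^esub>" if g: "g \<in> carrier \<G>" "\<forall>x\<in>\<Omega>. g x \<noteq> x" for g
  proof -
    have "derangement \<Omega> g" using g(2) by (auto simp: derangement_def invariants_def)
    then obtain m where "group.ord \<G> g = r ^ m" using assms(5) g(1) by (auto simp: r_element_def)
    then show ?thesis using pow_ord_eq_1[OF g(1)] by metis
  qed
  show ?thesis
    using affine_if_minimal_normal_comm[OF N]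
      almost_simple_if_minimal_normal_not_comm[OF assms(4) der N] by blast
qed

end
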